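(* Suppose $f$ and $g$ are two uniformly symmetric circle endomorphisms of the same degree $d\ge2$. Let $h$ be the conjugacy between $f$ and $g$ such that $h(1)=1$, that is, $h$ is an orientation-preserving homeomorphism of $T$ with $h(1)=1$ and $h\circ f=g\circ h$. Then $h$ is a symmetric homeomorphism if and only if the dual derivatives of $f$ and $g$ are the same, that is, $D^{*}(f)(w^{*})=D^{*}(g)(w^{*})$ for all $w^{*}\in\Sigma^{*}$.
   Context: $T$ is the unit circle. A circle endomorphism is an orientation-preserving covering map $f:T\to T$ of degree $d\ge2$ with $f(1)=1$; its lift is the homeomorphism $F:\mathbb{R}\to\mathbb{R}$ with $F(0)=0$, $F(x+1)=F(x)+d$ and $e^{2\pi i F(x)}=f(e^{2\pi i x})$. $f$ is uniformly symmetric if there is a bounded function $\varepsilon(t)>0$, $t>0$, with $\varepsilon(t)\to0$ as $t\to0^{+}$ and $$\frac{1}{1+\varepsilon(t)}\le\frac{|F^{-n}(x+t)-F^{-n}(x)|}{|F^{-n}(x)-F^{-n}(x-t)|}\le 1+\varepsilon(t)\quad\text{for all }x\in\mathbb{R},\ t>0,\ n>0.$$ An orientation-preserving homeomorphism $h$ of $T$ with lift $H$ ($H(x+1)=H(x)+1$) is symmetric if there is a bounded function $\varepsilon(t)>0$ with $\varepsilon(t)\to0$ as $t\to0^+$ and $\frac1{1+\varepsilon(t)}\le\frac{|H(x+t)-H(x)|}{|H(x)-H(x-t)|}\le1+\varepsilon(t)$ for all $x\in\mathbb{R}$, $t>0$. Dual derivative: for a word $w_n=i_0\cdots i_{n-1}$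 in digits $\{0,\dots,d-1\}$ let $I_{w_n}=F^{-n}([m,m+1])\subset[0,1]$, $m=i_{n-1}+i_{n-2}d+\cdots+i_0d^{n-1}$. $\Sigma^{*}$ is the space of left-infinite sequences $w^{*}=\cdots j_{n-1}\cdots j_1j_0$ with digits in $\{0,\dots,d-1\}$. The dual derivative is $D^{*}(f)(w^{*})=\lim_{n\to\infty}|I_{v_{n-1}}|/|I_{w_n}|$, where $w_n=j_{n-1}\cdots j_1j_0$ and $v_{n-1}=j_{n-1}\cdots j_1$ read left to right as words; for uniformly symmetric $f$ the limit exists for all $w^{*}$. *)

theory Defs
  imports "HOL-Analysis.Analysis"
begin

abbreviation circle :: "complex set"
  where "circle \<equiv> sphere 0 1"

text \<open>
  Maps of the circle are functions \<open>complex \<Rightarrow> complex\<close> of which only the values on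
  \<^term>\<open>circle\<close> matter.  A map is orientation preserving of degree \<open>d\<close> if it has an
  increasing lift \<open>F\<close> through \<open>x \<mapsto> e\<^sup>2\<^sup>\<pi>\<^sup>i\<^sup>x\<close> with \<open>F (x + 1) = F x + d\<close>.
\<close>

definition circle_lift :: "nat \<Rightarrow> (complex \<Rightarrow> complex) \<Rightarrow> (real \<Rightarrow> real) \<Rightarrow> bool"
  where "circle_lift d f F \<longleftrightarrow>
    (\<exists>G. homeomorphism UNIV UNIV F G) \<and> strict_mono F \<and>
    (\<forall>x. F (x + 1) = F x + real d) \<and>
    (\<forall>x. cis (2 * pi * F x) = f (cis (2 * pi * x)))"

definition circle_endomorphism :: "nat \<Rightarrow> (complex \<Rightarrow> complex) \<Rightarrow> bool"
  where "circle_endomorphism d f \<longleftrightarrow>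
    d \<ge> 2 \<and> covering_space circle f circle \<and> f 1 = 1 \<and> (\<exists>F. circle_lift d f F)"

definition endo_lift :: "nat \<Rightarrow> (complex \<Rightarrow> complex) \<Rightarrow> real \<Rightarrow> real"
  where "endo_lift d f = (THE F. circle_lift d f F \<and> F 0 = 0)"

lemma endo_lift_ex1:
  assumes "circle_endomorphism d f"
  shows "\<exists>!F. circle_lift d f F \<and> F 0 = 0"
proof -
  have exp_Ints: "x \<in> \<int>" if "cis (2 * pi * x) = 1" for x :: real
  proof -
    from that have "cos (2 * pi * x) = 1" by (metis cis.simps(1) one_complex.simps(1))
    then obtain n :: int where "2 * pi * x = of_int n * 2 * pi"
      by (metis cos_one_2pi_int)
    then show ?thesis by simp
  qed
  obtain F0 where F0: "circle_lift d f F0" and f1: "f 1 = 1"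
    using assms by (auto simp: circle_endomorphism_def)
  have "cis (2 * pi * F0 0) = 1"
    using F0 f1 by (auto simp: circle_lift_def dest!: spec[where x=0])
  then obtain k where k: "F0 0 = of_int k" using exp_Ints Ints_cases by blast
  define F where "F = (\<lambda>x. F0 x - of_int k)"
  have cisk: "cis (2 * pi * (y - of_int k)) = cis (2 * pi * y)" for y
    by (simp add: right_diff_distrib flip: cis_divide)
  have "circle_lift d f F \<and> F 0 = 0"
  proof -
    obtain G where G: "homeomorphism UNIV UNIV F0 G"
      using F0 by (auto simp: circle_lift_def)
    have "homeomorphism UNIV UNIV F (G \<circ> (\<lambda>y. y + of_int k))"
    proof -
      have "homeomorphism UNIV UNIV (\<lambda>y::real. y - of_int k) (\<lambda>y. y + of_int k)"
        by (rule homeomorphismI) (auto intro!: continuous_intros)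
      from homeomorphism_compose[OF G this] show ?thesis
        by (simp add: F_def o_def)
    qed
    then show ?thesis
      using F0 k cisk by (auto simp: circle_lift_def F_def strict_mono_def)
  qed
  moreover have "F1 = F2" if
    1: "circle_lift d f F1 \<and> F1 0 = 0" and 2: "circle_lift d f F2 \<and> F2 0 = 0" for F1 F2
  proof
    fix x
    let ?D = "\<lambda>x. F1 x - F2 x"
    have cont: "continuous_on UNIV ?D"
      using 1 2 by (auto simp: circle_lift_def homeomorphism_def intro!: continuous_intros)
    have "cis (2 * pi * ?D y) = 1" for y
    proof -
      have "cis (2 * pi * F1 y) = cis (2 * pi * F2 y)"
        using 1 2 by (simp add: circle_lift_def)
      then show ?thesis by (simp add: right_diff_distrib flip: cis_divide)
    qed
    then have Ints: "?D y \<in> \<int>" for y by (rule exp_Ints)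
    have "?D constant_on UNIV"
    proof (rule continuous_discrete_range_constant[OF connected_UNIV cont])
      fix y :: real
      have "1 \<le> norm (?D z - ?D y)" if "?D z \<noteq> ?D y" for z
        using Ints_nonzero_abs_ge1[of "?D z - ?D y"] Ints that by auto
      then show "\<exists>e>0. \<forall>z. z \<in> UNIV \<and> ?D z \<noteq> ?D y \<longrightarrow> e \<le> norm (?D z - ?D y)"
        by (intro exI[of _ 1]) auto
    qed
    then have "?D x = ?D 0" by (metis (no_types, lifting) UNIV_I constant_on_def)
    then show "F1 x = F2 x" using 1 2 by simp
  qed
  ultimately show ?thesis by blast
qed

definition vanishing_gauge :: "(real \<Rightarrow> real) \<Rightarrow> bool"
  where "vanishing_gauge \<epsilon> \<longleftrightarrow>
    (\<forall>t>0. \<epsilon> t > 0) \<and> bounded (\<epsilon> ` {0<..}) \<and> (\<epsilon> \<longlongrightarrow> 0) (at_right 0)"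

definition symmetric_with :: "(real \<Rightarrow> real) \<Rightarrow> (real \<Rightarrow> real) \<Rightarrow> bool"
  where "symmetric_with \<epsilon> K \<longleftrightarrow>
    (\<forall>x. \<forall>t>0. 1 / (1 + \<epsilon> t) \<le> \<bar>K (x + t) - K x\<bar> / \<bar>K x - K (x - t)\<bar> \<and>
               \<bar>K (x + t) - K x\<bar> / \<bar>K x - K (x - t)\<bar> \<le> 1 + \<epsilon> t)"

text \<open>A single \<open>\<epsilon>\<close> has to serve all inverse iterates.\<close>

definition uniformly_symmetric :: "nat \<Rightarrow> (complex \<Rightarrow> complex) \<Rightarrow> bool"
  where "uniformly_symmetric d f \<longleftrightarrow>
    (\<exists>\<epsilon>. vanishing_gauge \<epsilon> \<and> (\<forall>n>0. symmetric_with \<epsilon> (inv (endo_lift d f) ^^ n)))"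

definition orientation_preserving_circle_homeo :: "(complex \<Rightarrow> complex) \<Rightarrow> bool"
  where "orientation_preserving_circle_homeo h \<longleftrightarrow>
    (\<exists>k. homeomorphism circle circle h k) \<and> (\<exists>H. circle_lift 1 h H)"

text \<open>
  A lift of \<open>h\<close> is unique up to an additive integer, which does not affect the
  quotients, so it is immaterial which lift is used.
\<close>

definition symmetric_circle_homeo :: "(complex \<Rightarrow> complex) \<Rightarrow> bool"
  where "symmetric_circle_homeo h \<longleftrightarrow>
    orientation_preserving_circle_homeo h \<and>
    (\<exists>H \<epsilon>. circle_lift 1 h H \<and> vanishing_gauge \<epsilon> \<and> symmetric_with \<epsilon> H)"

definition word_value :: "nat \<Rightarrow> nat list \<Rightarrow> nat"
  where "word_value d w = (\<Sum>k<length w. w ! k * d ^ (length w - 1 - k))"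

definition word_interval :: "nat \<Rightarrow> (complex \<Rightarrow> complex) \<Rightarrow> nat list \<Rightarrow> real set"
  where "word_interval d f w =
    (inv (endo_lift d f) ^^ length w) ` {real (word_value d w)..real (word_value d w) + 1}"

text \<open>
  A left-infinite sequence \<open>\<dots>j\<^sub>2j\<^sub>1j\<^sub>0\<close> is the function \<open>k \<mapsto> j\<^sub>k\<close>; its final words of
  length \<open>n\<close> are thus read with descending indices.
\<close>

definition dual_sequences :: "nat \<Rightarrow> (nat \<Rightarrow> nat) set"
  where "dual_sequences d = {j. \<forall>k. j k < d}"

definition dual_derivative :: "nat \<Rightarrow> (complex \<Rightarrow> complex) \<Rightarrow> (nat \<Rightarrow> nat) \<Rightarrow> real"
  where "dual_derivative d f j =
    lim (\<lambda>n. measure lborel (word_interval d f (map j (rev [1..<n]))) /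
             measure lborel (word_interval d f (map j (rev [0..<n]))))"

end

theory Submission
  imports Defs
begin

text \<open>
  A homeomorphism satisfying the symmetry condition is almost affine at small scales: cutting a short
  interval into finitely many equal pieces shows that its difference quotients over any two
  subintervals of comparable length are almost equal.  Applied to \<open>F\<^sup>-\<^sup>k\<close>, uniformly in \<open>k\<close>, this makes the
  ratios \<open>|I\<^sub>v|/|I\<^sub>w|\<close> converge uniformly to the dual derivative; applied to \<open>H\<close>, it shows that a
  symmetric conjugacy preserves the limits.

  Conversely, let \<open>R\<close> be the quotient of the lengths of the cells \<open>G\<^sup>-\<^sup>n[m, m + 1] = H (F\<^sup>-\<^sup>n[m, m + 1])\<close>
  and \<open>F\<^sup>-\<^sup>n[m, m + 1]\<close>.  Equal dual derivatives make \<open>R\<close> almost unchanged under passing from a cell to its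
  parent, hence almost equal for neighbouring cells with a common ancestor few levels up.  The
  neighbours \<open>m - 1\<close> and \<open>m\<close> have no such ancestor if \<open>d\<^sup>r\<close> divides \<open>m\<close> for a large \<open>r\<close>; then the quotient
  of the two cells is almost that of \<open>F\<^sup>-\<^sup>r[0, 1]\<close> and \<open>F\<^sup>-\<^sup>r[-1, 0]\<close>, which in turn is also seen at the point \<open>d\<^sup>r\<close>
  of a much deeper level, where a common ancestor exists.  So \<open>R\<close> is almost equal for all neighbours of
  a deep level, and filling an interval with a bounded number of relatively small cells shows that
  \<open>H\<close> is symmetric.
\<close>

section \<open>Almost affine behaviour at small scales\<close>

definition slope :: "(real \<Rightarrow> real) \<Rightarrow> real \<Rightarrow> real \<Rightarrow> real"
  where "slope K u v = (K v - K u) / (v - u)"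

lemma slope_pos: "strict_mono K \<Longrightarrow> u < v \<Longrightarrow> 0 < slope K u v"
  by (simp add: slope_def strict_mono_less)

lemma slope_times: "u < v \<Longrightarrow> slope K u v * (v - u) = K v - K u"
  by (simp add: slope_def)

lemma grid_sum_le:
  fixes A B :: "nat \<Rightarrow> real"
  assumes "\<And>i. i < Q \<Longrightarrow> A (Suc i) - A i \<le> B (Suc i) - B i" and "p \<le> q" "q \<le> Q"
  shows "A q - A p \<le> B q - B p"
  using assms(2,3)
proof (induction q rule: dec_induct)
  case (step q)
  then show ?case using assms(1)[of q] by simp
qed simp

lemma grid_locate:
  fixes \<Phi> :: "nat \<Rightarrow> real"
  assumes "0 < Q" "\<Phi> 0 \<le> u" "u \<le> \<Phi> Q"
  obtains i where "i < Q" "\<Phi> i \<le> u" "u \<le> \<Phi> (Suc i)"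
  using assms
proof (induction Q arbitrary: thesis)
  case (Suc Q)
  show ?case
  proof (cases "0 < Q \<and> u \<le> \<Phi> Q")
    case True
    then show ?thesis using Suc.IH Suc.prems less_SucI by metis
  next
    case False
    then have "\<Phi> Q \<le> u" using Suc.prems by (cases "Q = 0") auto
    then show ?thesis using Suc.prems by blast
  qed
qed simp

text \<open>Moving \<open>u\<close> and \<open>v\<close> to grid points, outwards for the upper
  bound and inwards for the lower one, turns the increment into a sum over whole grid cells. Each
  end moves by at most one cell, hence by at most \<open>\<theta> * (v - u)\<close>.\<close>

lemma grid_increment_bounds:
  fixes \<Phi> :: "nat \<Rightarrow> real"
  assumes K: "mono K" and \<Phi>: "mono \<Phi>" and "0 < Q" and uv: "\<Phi> 0 \<le> u" "u < v" "v \<le> \<Phi> Q"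
    and \<alpha>: "0 \<le> \<alpha>" "\<And>i. i < Q \<Longrightarrow> \<alpha> * (\<Phi> (Suc i) - \<Phi> i) \<le> K (\<Phi> (Suc i)) - K (\<Phi> i)"
    and \<beta>: "0 \<le> \<beta>" "\<And>i. i < Q \<Longrightarrow> K (\<Phi> (Suc i)) - K (\<Phi> i) \<le> \<beta> * (\<Phi> (Suc i) - \<Phi> i)"
    and mesh: "\<And>i. i < Q \<Longrightarrow> \<Phi> (Suc i) - \<Phi> i \<le> \<theta> * (v - u)"
  shows "\<alpha> * ((1 - 2 * \<theta>) * (v - u)) \<le> K v - K u" (is ?lower)
    and "K v - K u \<le> \<beta> * ((1 + 2 * \<theta>) * (v - u))" (is ?upper)
proof -
  obtain i where i: "i < Q" "\<Phi> i \<le> u" "u \<le> \<Phi> (Suc i)"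
    using grid_locate[of Q \<Phi> u] assms by auto
  obtain j where j: "j < Q" "\<Phi> j \<le> v" "v \<le> \<Phi> (Suc j)"
    using grid_locate[of Q \<Phi> v] assms by auto
  have ij: "i \<le> j"
    using monoD[OF \<Phi>, of "Suc j" i] i j uv by (cases "i \<le> j") auto
  have "K v - K u \<le> K (\<Phi> (Suc j)) - K (\<Phi> i)"
    using monoD[OF K j(3)] monoD[OF K i(2)] by simp
  also have "\<dots> \<le> \<beta> * \<Phi> (Suc j) - \<beta> * \<Phi> i"
    by (rule grid_sum_le[of Q "\<lambda>i. K (\<Phi> i)" "\<lambda>i. \<beta> * \<Phi> i"])
      (use \<beta> ij j in \<open>auto simp: algebra_simps\<close>)
  also have "\<dots> \<le> \<beta> * ((1 + 2 * \<theta>) * (v - u))"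
    unfolding right_diff_distrib[symmetric]
    by (rule mult_left_mono[OF _ \<beta>(1)])
      (use mesh[OF i(1)] mesh[OF j(1)] i j in \<open>simp add: algebra_simps\<close>)
  finally show ?upper .
  show ?lower
  proof (cases "Suc i \<le> j")
    case True
    have "\<alpha> * ((1 - 2 * \<theta>) * (v - u)) \<le> \<alpha> * (\<Phi> j - \<Phi> (Suc i))"
      by (rule mult_left_mono[OF _ \<alpha>(1)])
        (use mesh[OF i(1)] mesh[OF j(1)] i j in \<open>simp add: algebra_simps\<close>)
    also have "\<dots> = \<alpha> * \<Phi> j - \<alpha> * \<Phi> (Suc i)" by (simp add: algebra_simps)
    also have "\<dots> \<le> K (\<Phi> j) - K (\<Phi> (Suc i))"
      by (rule grid_sum_le[of Q "\<lambda>i. \<alpha> * \<Phi> i" "\<lambda>i. K (\<Phi> i)"])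
        (use \<alpha> True j in \<open>auto simp: algebra_simps\<close>)
    also have "\<dots> \<le> K v - K u"
      using monoD[OF K j(2)] monoD[OF K i(3)] by simp
    finally show ?thesis .
  next
    case False
    \<comment> \<open>Both ends lie in one grid cell, so the mesh bound forces
      \<open>1 \<le> \<theta>\<close> and the claimed lower bound is not positive.\<close>
    then have "v - u \<le> \<theta> * (v - u)" using ij i j mesh[OF i(1)] by (auto simp: not_le less_Suc_eq_le)
    then have "1 \<le> \<theta>" using uv by simp
    then have "\<alpha> * ((1 - 2 * \<theta>) * (v - u)) \<le> 0"
      using \<alpha>(1) uv by (simp add: mult_nonneg_nonpos mult_nonpos_nonneg)
    then show ?thesis using monoD[OF K, of u v] uv by simp
  qed
qed

text \<open>Adjacent grid slopes differ by at most the factor \<open>\<eta>\<close>, so each is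
  within \<open>\<eta> ^ Q\<close> of the first one. Comparing two intervals through the first cell
  costs \<open>\<eta> ^ (2 * Q)\<close>, and their end pieces cost the factor in
  \<open>\<theta>\<close>. The grid may be uneven: later its points are endpoints of cells.\<close>

lemma grid_slope_compare:
  fixes \<Phi> :: "nat \<Rightarrow> real"
  assumes K: "strict_mono K" and \<Phi>: "strict_mono \<Phi>" and "0 < Q" and \<eta>: "1 \<le> \<eta>"
    and \<theta>: "0 \<le> \<theta>" "\<theta> < 1 / 2"
    and uv: "\<Phi> 0 \<le> u" "u < v" "v \<le> \<Phi> Q" and uv': "\<Phi> 0 \<le> u'" "u' < v'" "v' \<le> \<Phi> Q"
    and up: "\<And>i. Suc i < Q \<Longrightarrow> slope K (\<Phi> (Suc i)) (\<Phi> (Suc (Suc i))) \<le> \<eta> * slope K (\<Phi> i) (\<Phi> (Suc i))"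
    and down: "\<And>i. Suc i < Q \<Longrightarrow> slope K (\<Phi> i) (\<Phi> (Suc i)) \<le> \<eta> * slope K (\<Phi> (Suc i)) (\<Phi> (Suc (Suc i)))"
    and mesh: "\<And>i. i < Q \<Longrightarrow> \<Phi> (Suc i) - \<Phi> i \<le> \<theta> * (v - u)"
      "\<And>i. i < Q \<Longrightarrow> \<Phi> (Suc i) - \<Phi> i \<le> \<theta> * (v' - u')"
  shows "slope K u v \<le> \<eta> ^ (2 * Q) * ((1 + 2 * \<theta>) / (1 - 2 * \<theta>)) * slope K u' v'"
proof -
  define s where "s i = slope K (\<Phi> i) (\<Phi> (Suc i))" for i
  have s_pos: "0 < s i" for i
    unfolding s_def by (rule slope_pos[OF K]) (simp add: \<Phi> strict_mono_less)
  have s_eq: "K (\<Phi> (Suc i)) - K (\<Phi> i) = s i * (\<Phi> (Suc i) - \<Phi> i)" for i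
    unfolding s_def by (subst slope_times) (simp_all add: \<Phi> strict_mono_less)
  have \<Phi>_le: "\<Phi> i \<le> \<Phi> (Suc i)" for i by (simp add: \<Phi> strict_mono_less_eq)
  have step: "s i \<le> \<eta> ^ i * s 0 \<and> s 0 \<le> \<eta> ^ i * s i" if "i < Q" for i
    using that
  proof (induction i)
    case (Suc i)
    have "s (Suc i) \<le> \<eta> * s i" "s i \<le> \<eta> * s (Suc i)"
      using up[of i] down[of i] Suc.prems by (simp_all add: s_def)
    moreover have "\<eta> * s i \<le> \<eta> * (\<eta> ^ i * s 0)" "\<eta> ^ i * s i \<le> \<eta> ^ i * (\<eta> * s (Suc i))"
      using Suc \<eta> calculation by (auto intro!: mult_left_mono)
    ultimately show ?case using Suc by (simp add: mult.assoc mult.left_commute)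
  qed simp
  have pow: "\<eta> ^ i \<le> \<eta> ^ Q" "0 < \<eta> ^ Q" if "i < Q" for i
    using that \<eta> by (auto intro: power_increasing)
  have b: "s i \<le> \<eta> ^ Q * s 0" "s 0 / \<eta> ^ Q \<le> s i" if "i < Q" for i
  proof -
    have "\<eta> ^ i * s 0 \<le> \<eta> ^ Q * s 0" "\<eta> ^ i * s i \<le> \<eta> ^ Q * s i"
      using pow[OF that] s_pos less_imp_le by (auto intro!: mult_right_mono)
    then show "s i \<le> \<eta> ^ Q * s 0" "s 0 / \<eta> ^ Q \<le> s i"
      using step[OF that] pow[OF that] by (auto simp: divide_le_eq mult.commute)
  qed
  have E: "0 < \<eta> ^ Q" using \<eta> by simp
  have upper: "K v - K u \<le> (\<eta> ^ Q * s 0) * ((1 + 2 * \<theta>) * (v - u))"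
    by (rule grid_increment_bounds(2)[of K \<Phi> Q u v 0])
      (use assms s_pos[of 0] E b \<Phi>_le in \<open>auto simp: s_eq strict_mono_mono intro!: mult_nonneg_nonneg mult_right_mono less_imp_le[OF s_pos]\<close>)
  define \<alpha> where "\<alpha> = s 0 / \<eta> ^ Q"
  have \<alpha>: "0 \<le> \<alpha>" "\<alpha> \<le> s i" if "i < Q" for i
    using b(2)[OF that] s_pos[of 0] E by (simp_all add: \<alpha>_def)
  have lower: "\<alpha> * ((1 - 2 * \<theta>) * (v' - u')) \<le> K v' - K u'"
    by (rule grid_increment_bounds(1)[of K \<Phi> Q u' v' _ "\<eta> ^ Q * s 0"])
      (use assms s_pos[of 0] E b \<alpha> \<Phi>_le in \<open>auto simp: s_eq strict_mono_mono intro!: mult_nonneg_nonneg mult_right_mono less_imp_le[OF s_pos]\<close>)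
  have "slope K u v \<le> \<eta> ^ Q * s 0 * (1 + 2 * \<theta>)"
    unfolding slope_def using upper uv by (simp add: divide_le_eq mult.assoc)
  also have "\<dots> = (\<eta> ^ (2 * Q) * ((1 + 2 * \<theta>) / (1 - 2 * \<theta>))) * (\<alpha> * (1 - 2 * \<theta>))"
    using E \<theta> by (simp add: \<alpha>_def power_even_eq power2_eq_square)
  also have "\<dots> \<le> (\<eta> ^ (2 * Q) * ((1 + 2 * \<theta>) / (1 - 2 * \<theta>))) * slope K u' v'"
  proof (rule mult_left_mono)
    show "\<alpha> * (1 - 2 * \<theta>) \<le> slope K u' v'"
      unfolding slope_def using lower uv' by (simp add: pos_le_divide_eq mult.assoc)
    show "0 \<le> \<eta> ^ (2 * Q) * ((1 + 2 * \<theta>) / (1 - 2 * \<theta>))"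
      using \<theta> \<eta> by simp
  qed
  finally show ?thesis .
qed

text \<open>The order of choices matters: the mesh \<open>\<theta>\<close> determines the number
  \<open>Q\<close> of grid cells, and only then is \<open>\<eta>\<close> taken close enough to
  1.\<close>

lemma grid_constants:
  fixes c :: real
  assumes "1 < c"
  obtains \<theta> where "0 < \<theta>" "\<theta> < 1 / 2"
    "\<And>Q. \<exists>\<eta>>1. \<eta> ^ (2 * Q) * ((1 + 2 * \<theta>) / (1 - 2 * \<theta>)) \<le> c"
proof -
  define \<mu> where "\<mu> = sqrt c"
  have \<mu>: "1 < \<mu>" "\<mu> * \<mu> = c" using assms by (auto simp: \<mu>_def)
  \<comment> \<open>This is the solution of
    \<open>(1 + 2 * \<theta>) / (1 - 2 * \<theta>) = \<mu>\<close>.\<close>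
  define \<theta> where "\<theta> = (\<mu> - 1) / (2 * (\<mu> + 1))"
  have \<theta>: "0 < \<theta>" "\<theta> < 1 / 2" using \<mu> by (auto simp: \<theta>_def field_simps)
  have "2 * (\<theta> * (\<mu> + 1)) = \<mu> - 1"
    using \<mu>(1) by (simp add: \<theta>_def divide_simps)
  then have "1 + 2 * \<theta> = \<mu> * (1 - 2 * \<theta>)" by algebra
  then have eq: "(1 + 2 * \<theta>) / (1 - 2 * \<theta>) = \<mu>"
    using \<theta>(2) by (simp add: divide_eq_eq)
  show ?thesis
  proof (rule that[OF \<theta>])
    fix Q
    \<comment> \<open>The index \<open>Suc (2 * Q)\<close> stays positive for
      \<open>Q = 0\<close>.\<close>
    define \<eta> where "\<eta> = root (Suc (2 * Q)) \<mu>"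
    have "1 < \<eta>" "\<eta> ^ Suc (2 * Q) = \<mu>"
      unfolding \<eta>_def using \<mu> by (simp, intro real_root_pow_pos2) auto
    then have "1 < \<eta>" "\<eta> ^ (2 * Q) \<le> \<mu>"
      using power_increasing[of "2 * Q" "Suc (2 * Q)" \<eta>] by auto
    then show "\<exists>\<eta>>1. \<eta> ^ (2 * Q) * ((1 + 2 * \<theta>) / (1 - 2 * \<theta>)) \<le> c"
      unfolding eq \<mu>(2)[symmetric] using \<mu>(1) by (intro exI[of _ \<eta>]) auto
  qed
qed

lemma symmetric_withD:
  assumes "strict_mono K" "symmetric_with \<epsilon> K" "0 < t" "0 < \<epsilon> t"
  shows "K (x + t) - K x \<le> (1 + \<epsilon> t) * (K x - K (x - t))"
    and "K x - K (x - t) \<le> (1 + \<epsilon> t) * (K (x + t) - K x)"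
proof -
  have "0 < K (x + t) - K x" "0 < K x - K (x - t)"
    using assms by (simp_all add: strict_mono_less)
  moreover have "1 / (1 + \<epsilon> t) \<le> \<bar>K (x + t) - K x\<bar> / \<bar>K x - K (x - t)\<bar>"
    "\<bar>K (x + t) - K x\<bar> / \<bar>K x - K (x - t)\<bar> \<le> 1 + \<epsilon> t"
    using assms unfolding symmetric_with_def by blast+
  ultimately show "K (x + t) - K x \<le> (1 + \<epsilon> t) * (K x - K (x - t))"
    "K x - K (x - t) \<le> (1 + \<epsilon> t) * (K (x + t) - K x)"
    using assms(4) by (simp_all add: field_simps)
qed

text \<open>Cut \<open>[a, b]\<close> into \<open>N\<close> equal pieces: symmetry at the scale of
  one piece makes adjacent slopes nearly equal. The threshold \<open>t0\<close> depends on
  \<open>\<epsilon>\<close>, \<open>C\<close> and \<open>c\<close> but not on \<open>K\<close>, so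
  it serves all inverse iterates at once.\<close>

lemma symmetric_slopes_comparable:
  assumes \<epsilon>: "vanishing_gauge \<epsilon>" and C: "0 < C" and c: "1 < c"
  obtains t0 where "0 < t0"
    "\<And>K a b u v u' v'. \<lbrakk>strict_mono K; symmetric_with \<epsilon> K; b - a < t0;
       a \<le> u; u < v; v \<le> b; a \<le> u'; u' < v'; v' \<le> b; b - a \<le> C * (v - u); b - a \<le> C * (v' - u')\<rbrakk>
      \<Longrightarrow> slope K u v \<le> c * slope K u' v'"
proof -
  obtain \<theta> where \<theta>: "0 < \<theta>" "\<theta> < 1 / 2"
    "\<And>Q. \<exists>\<eta>>1. \<eta> ^ (2 * Q) * ((1 + 2 * \<theta>) / (1 - 2 * \<theta>)) \<le> c"
    using grid_constants[OF c] by blast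
  \<comment> \<open>With more than \<open>C / \<theta>\<close> pieces, one piece is at most
    \<open>\<theta>\<close> times either subinterval.\<close>
  obtain N where N: "C / \<theta> < real N" using reals_Archimedean2 by blast
  then have "0 < real N" using C \<theta>(1) by (meson divide_pos_pos less_trans)
  then have N0: "0 < N" by simp
  obtain \<eta> where \<eta>: "1 < \<eta>" "\<eta> ^ (2 * N) * ((1 + 2 * \<theta>) / (1 - 2 * \<theta>)) \<le> c"
    using \<theta>(3)[of N] by blast
  have "\<forall>\<^sub>F t in at_right 0. \<epsilon> t < \<eta> - 1"
    using \<epsilon> \<eta>(1) unfolding vanishing_gauge_def by (intro order_tendstoD(2)[where y = 0]) auto
  then obtain t0 where t0: "0 < t0" "\<And>t. 0 < t \<Longrightarrow> t < t0 \<Longrightarrow> \<epsilon> t < \<eta> - 1"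
    by (auto simp: eventually_at_right_field)
  show ?thesis
  proof (rule that[OF t0(1)])
    fix K a b u v u' v'
    assume K: "strict_mono K" "symmetric_with \<epsilon> K" and ab: "b - a < t0"
      and uv: "a \<le> u" "u < v" "v \<le> b" and uv': "a \<le> u'" "u' < v'" "v' \<le> b"
      and C': "b - a \<le> C * (v - u)" "b - a \<le> C * (v' - u')"
    define t where "t = (b - a) / real N"
    define \<Phi> where "\<Phi> i = a + real i * t" for i
    have t: "0 < t" using uv N0 by (simp add: t_def)
    have "t \<le> b - a" using uv N0 by (simp add: t_def divide_le_eq mult_le_cancel_left1)
    then have \<epsilon>t: "\<epsilon> t < \<eta> - 1" "0 < \<epsilon> t"
      using t0 t ab \<epsilon> by (auto simp: vanishing_gauge_def)
    have \<Phi>Suc: "\<Phi> (Suc i) = \<Phi> i + t" for i by (simp add: \<Phi>_def algebra_simps)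
    have \<Phi>: "strict_mono \<Phi>" using t by (auto simp: strict_mono_Suc_iff \<Phi>Suc)
    have nb: "K (\<Phi> i + t + t) - K (\<Phi> i + t) \<le> \<eta> * (K (\<Phi> i + t) - K (\<Phi> i))"
      "K (\<Phi> i + t) - K (\<Phi> i) \<le> \<eta> * (K (\<Phi> i + t + t) - K (\<Phi> i + t))" for i
    proof -
      have "0 < K (\<Phi> i + t) - K (\<Phi> i)" "0 < K (\<Phi> i + t + t) - K (\<Phi> i + t)"
        using t K(1) by (simp_all add: strict_mono_less)
      then have "(1 + \<epsilon> t) * (K (\<Phi> i + t) - K (\<Phi> i)) \<le> \<eta> * (K (\<Phi> i + t) - K (\<Phi> i))"
        "(1 + \<epsilon> t) * (K (\<Phi> i + t + t) - K (\<Phi> i + t)) \<le> \<eta> * (K (\<Phi> i + t + t) - K (\<Phi> i + t))"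
        using \<epsilon>t by (auto intro!: mult_right_mono)
      then show "K (\<Phi> i + t + t) - K (\<Phi> i + t) \<le> \<eta> * (K (\<Phi> i + t) - K (\<Phi> i))"
        "K (\<Phi> i + t) - K (\<Phi> i) \<le> \<eta> * (K (\<Phi> i + t + t) - K (\<Phi> i + t))"
        using symmetric_withD[OF K t \<epsilon>t(2), of "\<Phi> i + t"] by simp_all
    qed
    have mesh: "t \<le> \<theta> * w" if "b - a \<le> C * w" for w
    proof -
      have "t \<le> C * w / real N" unfolding t_def by (rule divide_right_mono[OF that]) simp
      also have "\<dots> = (C / real N) * w" by simp
      also have "\<dots> \<le> \<theta> * w"
      proof (rule mult_right_mono)
        show "C / real N \<le> \<theta>" using N N0 \<theta>(1) by (simp add: field_simps)
        have "0 \<le> C * w" using that uv by simp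
        then show "0 \<le> w" using C by (simp add: zero_le_mult_iff)
      qed
      finally show ?thesis .
    qed
    have "slope K u v \<le> \<eta> ^ (2 * N) * ((1 + 2 * \<theta>) / (1 - 2 * \<theta>)) * slope K u' v'"
    proof (rule grid_slope_compare[OF K(1) \<Phi> N0 _ _ \<theta>(2)])
      have ends: "\<Phi> 0 = a" "\<Phi> N = b" using N0 by (simp_all add: \<Phi>_def t_def)
      show "\<Phi> 0 \<le> u" "v \<le> \<Phi> N" "\<Phi> 0 \<le> u'" "v' \<le> \<Phi> N"
        using uv uv' by (simp_all add: ends)
    qed (use \<eta> \<theta> uv uv' t nb mesh C' in \<open>auto simp: \<Phi>Suc slope_def divide_right_mono\<close>)
    also have "\<dots> \<le> c * slope K u' v'"
      by (rule mult_right_mono[OF \<eta>(2)]) (use slope_pos[OF K(1) uv'(2)] in simp)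
    finally show "slope K u v \<le> c * slope K u' v'" .
  qed
qed

section \<open>Cells of the inverse iterates\<close>

lemma funpow_strict_mono: "strict_mono (K :: real \<Rightarrow> real) \<Longrightarrow> strict_mono (K ^^ n)"
  by (induction n) (auto simp: strict_mono_def)

text \<open>The index runs over all integers, so that the cells on both sides of an integer point
  can be compared.\<close>

definition cell :: "(real \<Rightarrow> real) \<Rightarrow> nat \<Rightarrow> int \<Rightarrow> real"
  where "cell F n m = (inv F ^^ n) (of_int (m + 1)) - (inv F ^^ n) (of_int m)"

text \<open>The index \<open>m div int d\<close> belongs to the parent, the cell of level
  \<open>n\<close> that contains the cell \<open>m\<close> of level \<open>n + 1\<close>. Along the
  final words of a left-infinite sequence these quotients tend to the dual derivative.\<close>

definition cell_ratio :: "nat \<Rightarrow> (real \<Rightarrow> real) \<Rightarrow> nat \<Rightarrow> int \<Rightarrow> real"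
  where "cell_ratio d F n m = cell F n (m div int d) / cell F (Suc n) m"

locale uniform_lift =
  fixes d :: nat and F :: "real \<Rightarrow> real" and \<epsilon> :: "real \<Rightarrow> real"
  assumes d: "2 \<le> d" and bij_F: "bij F" and mono_F: "strict_mono F" and F_0: "F 0 = 0"
    and F_add_1: "F (x + 1) = F x + real d"
    and gauge: "vanishing_gauge \<epsilon>"
    and sym_pos: "0 < n \<Longrightarrow> symmetric_with \<epsilon> (inv F ^^ n)"
begin

definition \<phi> :: "nat \<Rightarrow> real \<Rightarrow> real" where "\<phi> n = inv F ^^ n"

lemma \<phi>_id [simp]: "\<phi> 0 x = x"
  by (simp add: \<phi>_def)

lemma inv_F_\<phi>: "\<phi> (Suc n) x = inv F (\<phi> n x)"
  by (simp add: \<phi>_def)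

lemma \<phi>_Suc: "\<phi> (Suc n) x = \<phi> n (inv F x)"
  by (simp add: \<phi>_def funpow_swap1)

lemma cell_\<phi>: "cell F n m = \<phi> n (of_int (m + 1)) - \<phi> n (of_int m)"
  by (simp add: cell_def \<phi>_def)

lemma inv_F_F [simp]: "inv F (F x) = x"
  using bij_F by (simp add: bij_is_inj)

lemma F_inv_F [simp]: "F (inv F x) = x"
  using bij_F by (simp add: bij_is_surj surj_f_inv_f)

lemma \<phi>_funpow_F: "\<phi> n ((F ^^ n) x) = x"
  by (induction n) (simp_all add: \<phi>_Suc)

lemma mono_\<phi>: "strict_mono (\<phi> n)"
  unfolding \<phi>_def
proof (rule funpow_strict_mono)
  show "strict_mono (inv F)"
    by (metis F_inv_F mono_F strict_mono_def strict_mono_less)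
qed

lemma \<phi>_less [simp]: "\<phi> n x < \<phi> n y \<longleftrightarrow> x < y"
  using mono_\<phi> by (rule strict_mono_less)

lemma \<phi>_le [simp]: "\<phi> n x \<le> \<phi> n y \<longleftrightarrow> x \<le> y"
  using mono_\<phi> by (rule strict_mono_less_eq)

lemma F_add_int: "F (x + of_int k) = F x + real d * of_int k"
proof (induction k rule: int_induct[where k = 0])
  case (step1 i)
  then show ?case using F_add_1[of "x + of_int i"] by (simp add: algebra_simps)
next
  case (step2 i)
  then show ?case using F_add_1[of "x + of_int (i - 1)"] by (simp add: algebra_simps)
qed simp

lemma inv_F_add: "inv F (x + real d * of_int k) = inv F x + of_int k"
  by (metis F_add_int F_inv_F inv_F_F)

lemma \<phi>_add_int: "\<phi> n (x + real d ^ n * of_int k) = \<phi> n x + of_int k"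
proof (induction n arbitrary: x k)
  case (Suc n)
  have "\<phi> (Suc n) (x + real d ^ Suc n * of_int k)
      = inv F (\<phi> n (x + real d ^ n * of_int (int d * k)))"
    by (simp add: inv_F_\<phi> mult_ac)
  also have "\<dots> = inv F (\<phi> n x + real d * of_int k)"
    by (subst Suc.IH) simp
  finally show ?case by (simp add: inv_F_add inv_F_\<phi>)
qed simp

lemma \<phi>_0: "\<phi> n 0 = 0"
proof (induction n)
  case (Suc n)
  then show ?case using inv_F_F[of 0] F_0 by (simp add: inv_F_\<phi>)
qed simp

lemma \<phi>_power: "\<phi> n (real d ^ n * of_int k) = of_int k"
  using \<phi>_add_int[of n 0 k] by (simp add: \<phi>_0)

lemma \<phi>_add: "\<phi> (n + k) x = \<phi> k (\<phi> n x)"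
  by (subst add.commute) (simp add: \<phi>_def funpow_add)

text \<open>\<open>F\<close> sends the integer \<open>m\<close> to \<open>d * m\<close>, so the
  division points of one level are every \<open>d\<close>-th division point of the next. This is the
  nesting of cells.\<close>

lemma \<phi>_parent: "\<phi> (Suc n) (real d * of_int m) = \<phi> n (of_int m)"
  using inv_F_add[of 0 m] inv_F_F[of 0] by (simp add: \<phi>_Suc F_0)

lemma \<phi>_level: "\<phi> (n + r) (real d ^ r * of_int m) = \<phi> n (of_int m)"
  by (subst add.commute) (simp only: \<phi>_add \<phi>_power)

lemma symmetric_\<phi>: "symmetric_with \<epsilon> (\<phi> n)"
proof (cases "n = 0")
  case True
  then show ?thesis
    using gauge by (auto simp: \<phi>_def symmetric_with_def vanishing_gauge_def less_imp_le)
qed (use sym_pos in \<open>auto simp: \<phi>_def\<close>)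

lemma cell_pos: "0 < cell F n m"
  by (simp add: cell_\<phi>)

lemma cell_0: "cell F 0 m = 1"
  by (simp add: cell_\<phi>)

text \<open>Unit intervals are compared at scale 1, so one constant bounds the quotient of adjacent
  cells at every level.\<close>

definition M :: real where "M = 1 + \<epsilon> 1"

lemma M_gt_1: "1 < M"
  using gauge by (simp add: M_def vanishing_gauge_def)

lemma cell_neighbours: "cell F n (m + 1) \<le> M * cell F n m" "cell F n m \<le> M * cell F n (m + 1)"
  using symmetric_withD[OF mono_\<phi> symmetric_\<phi>, of 1 n "of_int m + 1"] gauge
  by (auto simp: cell_\<phi> M_def vanishing_gauge_def add.assoc)

lemma cell_distant: "cell F n m' \<le> M ^ nat \<bar>m' - m\<bar> * cell F n m"
proof -
  have up: "cell F n (m + int i) \<le> M ^ i * cell F n m" for m i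
  proof (induction i)
    case (Suc i)
    have "cell F n (m + int (Suc i)) \<le> M * cell F n (m + int i)"
      using cell_neighbours(1)[of n "m + int i"] by (simp add: ac_simps)
    also have "\<dots> \<le> M * (M ^ i * cell F n m)"
      using Suc M_gt_1 by (intro mult_left_mono) auto
    finally show ?case by (simp add: mult.assoc)
  qed simp
  have down: "cell F n m \<le> M ^ i * cell F n (m + int i)" for m i
  proof (induction i)
    case (Suc i)
    have "M ^ i * cell F n (m + int i) \<le> M ^ i * (M * cell F n (m + int (Suc i)))"
      using cell_neighbours(2)[of n "m + int i"] M_gt_1
      by (intro mult_left_mono) (auto simp: ac_simps)
    then show ?case using Suc by (simp add: mult_ac)
  qed simp
  show ?thesis
    using up[of m "nat (m' - m)"] down[of m' "nat (m - m')"] by (cases "m \<le> m'") auto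
qed

lemma interval_le_cell:
  assumes "i \<le> m" "m < i + int k"
  shows "\<phi> n (of_int (i + int k)) - \<phi> n (of_int i) \<le> real k * (M ^ k * cell F n m)"
proof -
  have "\<phi> n (of_int (i + int k)) - \<phi> n (of_int i) = (\<Sum>l<k. cell F n (i + int l))"
    by (induction k) (simp_all add: cell_\<phi> ac_simps)
  also have "\<dots> \<le> (\<Sum>l<k. M ^ k * cell F n m)"
  proof (rule sum_mono)
    fix l assume "l \<in> {..<k}"
    then have "nat \<bar>i + int l - m\<bar> \<le> k" using assms by auto
    then have "M ^ nat \<bar>i + int l - m\<bar> * cell F n m \<le> M ^ k * cell F n m"
      using M_gt_1 cell_pos[of n m] by (intro mult_right_mono power_increasing) auto
    then show "cell F n (i + int l) \<le> M ^ k * cell F n m"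
      using cell_distant[of n "i + int l" m] by simp
  qed
  finally show ?thesis by simp
qed

lemma cell_eq_children:
  "cell F n m = \<phi> (Suc n) (of_int (int d * m + int d)) - \<phi> (Suc n) (of_int (int d * m))"
  using \<phi>_parent[of n m] \<phi>_parent[of n "m + 1"] by (simp add: cell_\<phi> algebra_simps)

lemma child_bounds: "int d * (m div int d) \<le> m" "m < int d * (m div int d) + int d"
  using d mult_div_mod_eq[of "int d" m] pos_mod_bound[of "int d" m] pos_mod_sign[of "int d" m]
  by linarith+

lemma child_inside:
  "\<phi> n (of_int (m div int d)) \<le> \<phi> (Suc n) (of_int m)"
  "\<phi> (Suc n) (of_int (m + 1)) \<le> \<phi> n (of_int (m div int d + 1))"
proof -
  have "int d * (m div int d) \<le> m" "m + 1 \<le> int d * (m div int d + 1)"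
    using child_bounds[of m] by (simp_all add: distrib_left)
  then have "real d * of_int (m div int d) \<le> of_int m"
    "of_int (m + 1) \<le> real d * of_int (m div int d + 1)"
    by (simp_all only: of_int_le_iff[symmetric, where ?'a = real] of_int_mult of_int_of_nat_eq)
  then show "\<phi> n (of_int (m div int d)) \<le> \<phi> (Suc n) (of_int m)"
    "\<phi> (Suc n) (of_int (m + 1)) \<le> \<phi> n (of_int (m div int d + 1))"
    unfolding \<phi>_parent[of n "m div int d", symmetric] \<phi>_parent[of n "m div int d + 1", symmetric]
    by (simp_all only: \<phi>_le)
qed

text \<open>A parent consists of \<open>d\<close> children, each at most \<open>M ^ d\<close> times
  any other.\<close>

definition C :: real where "C = real d * M ^ d"

lemma cell_parent_le: "cell F n (m div int d) \<le> C * cell F (Suc n) m"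
  unfolding cell_eq_children[of n "m div int d"] C_def
  using interval_le_cell[OF child_bounds[of m], of "Suc n"] by (simp add: mult.assoc)

lemma C_gt_1: "1 < C"
proof -
  have "1 \<le> M ^ d" using M_gt_1 by simp
  then have "2 * 1 \<le> real d * M ^ d" using d by (intro mult_mono) auto
  then show ?thesis by (simp add: C_def)
qed

definition \<tau> :: real where "\<tau> = M / (M + 1)"

lemma \<tau>: "0 < \<tau>" "\<tau> < 1"
  using M_gt_1 by (auto simp: \<tau>_def)

text \<open>As \<open>2 \<le> d\<close>, a cell has an adjacent sibling, to its right or, for the
  last child, to its left. The sibling has at least \<open>1 / M\<close> of its length, which leaves
  at most \<open>M / (M + 1)\<close> of the parent.\<close>

lemma cell_child_le: "cell F (Suc n) m \<le> \<tau> * cell F n (m div int d)"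
proof -
  define i where "i = int d * (m div int d)"
  have i: "i \<le> m" "m < i + int d" using child_bounds[of m] by (simp_all add: i_def)
  have "(M + 1) * cell F (Suc n) m \<le> M * cell F n (m div int d)"
  proof (cases "m + 1 < i + int d")
    case True
    then have "\<phi> (Suc n) (of_int (m + 1 + 1)) \<le> \<phi> (Suc n) (of_int (i + int d))"
      "\<phi> (Suc n) (of_int i) \<le> \<phi> (Suc n) (of_int m)"
      using i by (simp_all only: \<phi>_le of_int_le_iff)
    then have "cell F (Suc n) m + cell F (Suc n) (m + 1) \<le> cell F n (m div int d)"
      unfolding cell_eq_children[of n "m div int d"] i_def[symmetric]
      by (simp add: cell_\<phi> del: \<phi>_le)
    then have "M * (cell F (Suc n) m + cell F (Suc n) (m + 1)) \<le> M * cell F n (m div int d)"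
      using M_gt_1 by (intro mult_left_mono) auto
    then show ?thesis using cell_neighbours(2)[of "Suc n" m] by (simp add: algebra_simps)
  next
    case False
    then have "\<phi> (Suc n) (of_int (m + 1)) \<le> \<phi> (Suc n) (of_int (i + int d))"
      "\<phi> (Suc n) (of_int i) \<le> \<phi> (Suc n) (of_int (m - 1))"
      using i d by (simp_all only: \<phi>_le of_int_le_iff)
    then have "cell F (Suc n) (m - 1) + cell F (Suc n) m \<le> cell F n (m div int d)"
      unfolding cell_eq_children[of n "m div int d"] i_def[symmetric]
      by (simp add: cell_\<phi> del: \<phi>_le)
    then have "M * (cell F (Suc n) (m - 1) + cell F (Suc n) m) \<le> M * cell F n (m div int d)"
      using M_gt_1 by (intro mult_left_mono) auto
    then show ?thesis using cell_neighbours(1)[of "Suc n" "m - 1"] by (simp add: algebra_simps)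
  qed
  then show ?thesis using M_gt_1 by (simp add: \<tau>_def pos_le_divide_eq mult.commute)
qed

lemma cell_descendant_le: "cell F (n + k) m \<le> \<tau> ^ k * cell F n (m div int d ^ k)"
proof (induction k arbitrary: m)
  case (Suc k)
  have "cell F (n + Suc k) m \<le> \<tau> * cell F (n + k) (m div int d)"
    using cell_child_le[of "n + k" m] by simp
  also have "\<dots> \<le> \<tau> * (\<tau> ^ k * cell F n (m div int d div int d ^ k))"
    using Suc \<tau> by (intro mult_left_mono) auto
  finally show ?case by (simp add: zdiv_zmult2_eq[symmetric] mult.assoc)
qed simp

lemma cell_le: "cell F n m \<le> \<tau> ^ n"
  using cell_descendant_le[of 0 n m] by (simp add: cell_0)

text \<open>This reads the level off the size: a cell shorter than \<open>(1 / C) ^ k\<close> has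
  level above \<open>k\<close>.\<close>

lemma cell_ge: "(1 / C) ^ n \<le> cell F n m"
proof (induction n arbitrary: m)
  case (Suc n)
  have "(1 / C) ^ Suc n \<le> (1 / C) * cell F n (m div int d)"
    unfolding power_Suc using Suc C_gt_1 by (intro mult_left_mono) auto
  also have "\<dots> \<le> cell F (Suc n) m"
    using cell_parent_le[of n m] C_gt_1 by (simp add: divide_le_eq mult.commute)
  finally show ?case .
qed (simp add: cell_0)

lemma cell_ratio_bounds: "1 \<le> cell_ratio d F n m" "cell_ratio d F n m \<le> C"
proof -
  have "cell F (Suc n) m \<le> 1 * cell F n (m div int d)"
    using cell_child_le[of n m] \<tau>(2) cell_pos[of n "m div int d"]
    by (meson less_imp_le mult_right_mono order_trans)
  then show "1 \<le> cell_ratio d F n m" "cell_ratio d F n m \<le> C"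
    unfolding cell_ratio_def using cell_parent_le[of n m] cell_pos[of "Suc n" m]
    by (simp_all add: divide_le_eq le_divide_eq)
qed

section \<open>Stability of length quotients under passage to deeper levels\<close>

lemma cells_small:
  assumes "0 < t"
  obtains n0 where "\<And>n m. n0 \<le> n \<Longrightarrow> cell F n m < t"
proof -
  obtain n0 where n0: "\<tau> ^ n0 < t"
    using \<tau> assms real_arch_pow_inv[of t \<tau>] by auto
  show ?thesis
  proof (rule that)
    fix n m assume "n0 \<le> n"
    then have "\<tau> ^ n \<le> \<tau> ^ n0" using \<tau> by (intro power_decreasing) auto
    then show "cell F n m < t" using cell_le[of n m] n0 by simp
  qed
qed

text \<open>A shift by \<open>d ^ n * l\<close> before applying \<open>\<phi> n\<close> is a shift
  by \<open>l\<close> afterwards. Hence a cell \<open>k\<close> levels deeper is the image under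
  \<open>\<phi> k\<close> of an integer translate of a cell of level \<open>n\<close>, and quotients
  at deep levels become quotients of slopes of \<open>\<phi> k\<close>.\<close>

lemma cell_slope:
  "cell F (n + k) (m + int d ^ n * l)
    = slope (\<phi> k) (\<phi> n (of_int m) + of_int l) (\<phi> n (of_int (m + 1)) + of_int l) * cell F n m"
proof -
  have e: "\<phi> n (of_int (j + int d ^ n * l)) = \<phi> n (of_int j) + of_int l" for j
    using \<phi>_add_int[of n "of_int j" l] by simp
  have "cell F (n + k) (m + int d ^ n * l)
      = \<phi> k (\<phi> n (of_int (m + 1 + int d ^ n * l))) - \<phi> k (\<phi> n (of_int (m + int d ^ n * l)))"
    unfolding cell_\<phi> \<phi>_add by (simp only: ac_simps)
  also have "\<dots> = \<phi> k (\<phi> n (of_int (m + 1)) + of_int l) - \<phi> k (\<phi> n (of_int m) + of_int l)"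
    by (simp only: e)
  finally show ?thesis
    using slope_times[of "\<phi> n (of_int m) + of_int l" "\<phi> n (of_int (m + 1)) + of_int l" "\<phi> k"]
    by (simp add: cell_\<phi>)
qed

text \<open>By \<open>cell_slope\<close> the quotient changes by the quotient of the slopes of
  \<open>\<phi> k\<close> over a parent and its child. The child has at least \<open>1 / C\<close>
  of the parent's length, so for short parents these slopes are nearly equal, uniformly in
  \<open>k\<close>.\<close>

lemma cell_ratio_stable:
  assumes "1 < c"
  obtains n0 where "\<And>n k m l. n0 \<le> n \<Longrightarrow>
    cell_ratio d F (n + k) (m + int d ^ Suc n * l) \<le> c * cell_ratio d F n m \<and>
    cell_ratio d F n m \<le> c * cell_ratio d F (n + k) (m + int d ^ Suc n * l)"
proof -
  obtain t0 where t0: "0 < t0"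
    "\<And>K a b u v u' v'. \<lbrakk>strict_mono K; symmetric_with \<epsilon> K; b - a < t0;
       a \<le> u; u < v; v \<le> b; a \<le> u'; u' < v'; v' \<le> b; b - a \<le> C * (v - u); b - a \<le> C * (v' - u')\<rbrakk>
      \<Longrightarrow> slope K u v \<le> c * slope K u' v'"
    using symmetric_slopes_comparable[OF gauge less_trans[OF zero_less_one C_gt_1] assms] by metis
  obtain n0 where n0: "\<And>n m. n0 \<le> n \<Longrightarrow> cell F n m < t0"
    using cells_small[OF t0(1)] by blast
  show ?thesis
  proof (rule that)
    fix n k m l assume "n0 \<le> n"
    define p where "p = m div int d"
    define a where "a = \<phi> n (of_int p) + of_int l"
    define b where "b = \<phi> n (of_int (p + 1)) + of_int l"
    define u where "u = \<phi> (Suc n) (of_int m) + of_int l"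
    define v where "v = \<phi> (Suc n) (of_int (m + 1)) + of_int l"
    have [simp]: "b - a = cell F n p" "v - u = cell F (Suc n) m"
      by (simp_all add: a_def b_def u_def v_def cell_\<phi>)
    have ab: "a < b" "u < v" by (simp_all add: a_def b_def u_def v_def)
    have sub: "a \<le> u" "v \<le> b"
      using child_inside[of n m] by (simp_all only: a_def b_def u_def v_def p_def add_le_cancel_right)
    have len: "cell F n p \<le> C * cell F (Suc n) m" "cell F n p \<le> C * cell F n p"
      using cell_parent_le[of n m] C_gt_1 cell_pos[of n p] by (simp_all add: p_def)
    \<comment> \<open>Passing to the parent turns the shift into \<open>d ^ n * l\<close>, so parent
      and child are translated by the same integer \<open>l\<close>.\<close>
    have "(m + int d ^ Suc n * l) div int d = p + int d ^ n * l"
      using d by (simp add: p_def mult.assoc div_add)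
    then have ratio: "cell_ratio d F (n + k) (m + int d ^ Suc n * l)
        = (slope (\<phi> k) a b / slope (\<phi> k) u v) * cell_ratio d F n m"
      unfolding cell_ratio_def using cell_slope[of n k p l] cell_slope[of "Suc n" k m l]
      by (simp add: a_def b_def u_def v_def p_def)
    have "slope (\<phi> k) a b \<le> c * slope (\<phi> k) u v" "slope (\<phi> k) u v \<le> c * slope (\<phi> k) a b"
      by (rule t0(2)[OF mono_\<phi> symmetric_\<phi>, of b a]; use n0[OF \<open>n0 \<le> n\<close>] ab sub len in simp)+
    then have "slope (\<phi> k) a b / slope (\<phi> k) u v \<le> c" "1 \<le> c * (slope (\<phi> k) a b / slope (\<phi> k) u v)"
      using slope_pos[OF mono_\<phi> ab(2), of k] by (simp_all add: divide_le_eq le_divide_eq)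
    from mult_right_mono[OF this(1), of "cell_ratio d F n m"]
      mult_right_mono[OF this(2), of "cell_ratio d F n m"]
    show "cell_ratio d F (n + k) (m + int d ^ Suc n * l) \<le> c * cell_ratio d F n m \<and>
      cell_ratio d F n m \<le> c * cell_ratio d F (n + k) (m + int d ^ Suc n * l)"
      using cell_ratio_bounds(1)[of n m] by (simp only: ratio mult.assoc mult_1)
  qed
qed

text \<open>The two cells meeting at \<open>d ^ r * l\<close> are the images under
  \<open>\<phi> k\<close> of the level-\<open>r\<close> cells on both sides of 0, translated by
  \<open>l\<close>. Their union is at most \<open>1 + M\<close> times either of them, so the slopes
  of \<open>\<phi> k\<close> over them are comparable.\<close>

lemma neighbours_at_multiples_stable:
  assumes "1 < c"
  obtains r0 where "\<And>r k l. r0 \<le> r \<Longrightarrow>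
    cell F (r + k) (int d ^ r * l) / cell F (r + k) (int d ^ r * l - 1) \<le> c * (cell F r 0 / cell F r (-1)) \<and>
    cell F r 0 / cell F r (-1) \<le> c * (cell F (r + k) (int d ^ r * l) / cell F (r + k) (int d ^ r * l - 1))"
proof -
  have M1: "0 < 1 + M" using M_gt_1 by simp
  obtain t0 where t0: "0 < t0"
    "\<And>K a b u v u' v'. \<lbrakk>strict_mono K; symmetric_with \<epsilon> K; b - a < t0;
       a \<le> u; u < v; v \<le> b; a \<le> u'; u' < v'; v' \<le> b; b - a \<le> (1 + M) * (v - u); b - a \<le> (1 + M) * (v' - u')\<rbrakk>
      \<Longrightarrow> slope K u v \<le> c * slope K u' v'"
    using symmetric_slopes_comparable[OF gauge M1 assms] by metis
  have "0 < t0 / 2" using t0(1) by simp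
  then obtain r0 where r0: "\<And>n m. r0 \<le> n \<Longrightarrow> cell F n m < t0 / 2"
    using cells_small by blast
  show ?thesis
  proof (rule that)
    fix r k l assume "r0 \<le> r"
    define a where "a = \<phi> r (of_int (-1)) + of_int l"
    define u where "u = \<phi> r (of_int 0) + of_int l"
    define b where "b = \<phi> r (of_int 1) + of_int l"
    have len: "u - a = cell F r (-1)" "b - u = cell F r 0"
      by (simp_all add: a_def b_def u_def cell_\<phi>)
    have aub: "a < u" "u < b" unfolding a_def u_def b_def by (simp_all del: of_int_minus)
    have ba: "b - a = cell F r (-1) + cell F r 0" using len by simp
    have "cell F r 0 \<le> M * cell F r (-1)" "cell F r (-1) \<le> M * cell F r 0"
      using cell_neighbours[of r "-1"] by simp_all
    then have "b - a \<le> (1 + M) * (u - a)" "b - a \<le> (1 + M) * (b - u)" "b - a < t0"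
      using r0[OF \<open>r0 \<le> r\<close>, of 0] r0[OF \<open>r0 \<le> r\<close>, of "-1"]
      unfolding ba len by (simp_all add: algebra_simps)
    then have "slope (\<phi> k) u b \<le> c * slope (\<phi> k) a u" "slope (\<phi> k) a u \<le> c * slope (\<phi> k) u b"
      by (intro t0(2)[OF mono_\<phi> symmetric_\<phi>, of b a]; use aub in simp)+
    then have s: "slope (\<phi> k) u b / slope (\<phi> k) a u \<le> c" "1 \<le> c * (slope (\<phi> k) u b / slope (\<phi> k) a u)"
      using slope_pos[OF mono_\<phi> aub(1), of k] by (simp_all add: divide_le_eq le_divide_eq)
    have ratio: "cell F (r + k) (int d ^ r * l) / cell F (r + k) (int d ^ r * l - 1)
        = (slope (\<phi> k) u b / slope (\<phi> k) a u) * (cell F r 0 / cell F r (-1))"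
      using cell_slope[of r k 0 l] cell_slope[of r k "-1" l]
      by (simp add: a_def b_def u_def)
    have "0 \<le> cell F r 0 / cell F r (-1)"
      using cell_pos[of r 0] cell_pos[of r "-1"] by simp
    from mult_right_mono[OF s(1) this] mult_right_mono[OF s(2) this]
    show "cell F (r + k) (int d ^ r * l) / cell F (r + k) (int d ^ r * l - 1) \<le> c * (cell F r 0 / cell F r (-1)) \<and>
      cell F r 0 / cell F r (-1) \<le> c * (cell F (r + k) (int d ^ r * l) / cell F (r + k) (int d ^ r * l - 1))"
      by (simp only: ratio mult.assoc mult_1)
  qed
qed

end

section \<open>Dual derivatives and conjugacies\<close>

text \<open>The last letter of a word is the units digit, so \<open>w k\<close> has weight
  \<open>d ^ k\<close>. Extending the word to the left adds a multiple of \<open>d ^ n\<close>;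
  dropping the last letter divides by \<open>d\<close> and so leads to the parent cell.\<close>

definition digit_value :: "nat \<Rightarrow> (nat \<Rightarrow> nat) \<Rightarrow> nat \<Rightarrow> int"
  where "digit_value d w n = (\<Sum>k<n. int (w k) * int d ^ k)"

lemma digit_value_shift: "digit_value d w (Suc n) = int (w 0) + int d * digit_value d (\<lambda>k. w (Suc k)) n"
  by (simp add: digit_value_def sum.lessThan_Suc_shift sum_distrib_left mult_ac del: sum.lessThan_Suc)

lemma digit_value_extend: "\<exists>l. digit_value d w (n + k) = digit_value d w n + int d ^ n * l"
proof (induction k)
  case (Suc k)
  then obtain l where "digit_value d w (n + k) = digit_value d w n + int d ^ n * l" by blast
  then have "digit_value d w (n + Suc k) = digit_value d w n + int d ^ n * (l + int d ^ k * int (w (n + k)))"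
    by (simp add: digit_value_def power_add algebra_simps)
  then show ?case by blast
qed (auto intro: exI[of _ 0])

text \<open>Every residue modulo \<open>d ^ n\<close> comes from a sequence of digits, so estimates
  over all sequences reach all cells.\<close>

lemma digit_value_digits:
  assumes "0 < d"
  shows "digit_value d (\<lambda>k. nat (m div int d ^ k mod int d)) n = m mod int d ^ n"
proof (induction n)
  case (Suc n)
  have "m mod int d ^ Suc n = int d ^ n * (m div int d ^ n mod int d) + m mod int d ^ n"
    using zmod_zmult2_eq[of "int d" m "int d ^ n"] assms by (simp add: mult.commute)
  then show ?case using Suc assms by (simp add: digit_value_def)
qed (simp add: digit_value_def)

lemma word_value_rev: "int (word_value d (map w (rev [0..<n]))) = digit_value d w n"
proof -
  have "int (word_value d (map w (rev [0..<n]))) = (\<Sum>k<n. int (w (n - Suc k)) * int d ^ (n - Suc k))"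
    unfolding word_value_def by (auto simp: rev_nth intro!: sum.cong)
  then show ?thesis
    unfolding digit_value_def using sum.nat_diff_reindex[of "\<lambda>k. int (w k) * int d ^ k" n] by simp
qed

section \<open>Dual derivatives as uniform limits of cell ratios\<close>

context uniform_lift
begin

lemma \<phi>_image: "\<phi> n ` {a..b} = {\<phi> n a..\<phi> n b}"
proof
  show "{\<phi> n a..\<phi> n b} \<subseteq> \<phi> n ` {a..b}"
  proof
    fix y assume "y \<in> {\<phi> n a..\<phi> n b}"
    then have "\<phi> n a \<le> \<phi> n ((F ^^ n) y)" "\<phi> n ((F ^^ n) y) \<le> \<phi> n b"
      by (simp_all only: \<phi>_funpow_F atLeastAtMost_iff)
    then have "(F ^^ n) y \<in> {a..b}" by simp
    then show "y \<in> \<phi> n ` {a..b}" using \<phi>_funpow_F[of n y] by (metis imageI)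
  qed
qed auto

lemma measure_word_interval:
  assumes "endo_lift d f = F"
  shows "measure lborel (word_interval d f ws) = cell F (length ws) (int (word_value d ws))"
proof -
  have "word_interval d f ws
      = {\<phi> (length ws) (of_int (int (word_value d ws)))..\<phi> (length ws) (of_int (int (word_value d ws) + 1))}"
    unfolding word_interval_def assms \<phi>_def[symmetric] \<phi>_image by simp
  then show ?thesis by (simp add: cell_\<phi> del: of_int_add of_int_of_nat_eq)
qed

lemma dual_derivative_eq_lim:
  assumes "endo_lift d f = F" and "w \<in> dual_sequences d"
  shows "dual_derivative d f w = lim (\<lambda>n. cell_ratio d F n (digit_value d w (Suc n)))"
proof -
  define X where "X n = measure lborel (word_interval d f (map w (rev [1..<n]))) /
             measure lborel (word_interval d f (map w (rev [0..<n])))" for n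
  have "X (Suc n) = cell_ratio d F n (digit_value d w (Suc n))" for n
  proof -
    have "map w (rev [1..<Suc n]) = map (\<lambda>k. w (Suc k)) (rev [0..<n])"
      by (simp add: map_Suc_upt[symmetric] rev_map comp_def del: upt_Suc)
    moreover have "digit_value d w (Suc n) div int d = digit_value d (\<lambda>k. w (Suc k)) n"
      using assms(2) d by (simp add: digit_value_shift dual_sequences_def div_add1_eq)
    ultimately show ?thesis
      by (simp add: X_def cell_ratio_def measure_word_interval[OF assms(1)] word_value_rev del: upt_Suc)
  qed
  \<comment> \<open>A word of \<open>n + 1\<close> letters has its parent at level \<open>n\<close>,
    which shifts the index of the sequence by one.\<close>
  then have "(\<lambda>n. cell_ratio d F n (digit_value d w (Suc n))) \<longlonglongrightarrow> L \<longleftrightarrow> X \<longlonglongrightarrow> L" for L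
    using filterlim_sequentially_Suc[of X "nhds L"] by simp
  then show ?thesis unfolding dual_derivative_def lim_def X_def[symmetric] by simp
qed

text \<open>Longer final words change the index by multiples of \<open>d ^ Suc n\<close>, so
  \<open>cell_ratio_stable\<close> gives a multiplicative Cauchy condition. The bound
  \<open>C\<close> on the ratios makes it additive.\<close>

lemma cell_ratio_digits_convergent: "convergent (\<lambda>n. cell_ratio d F n (digit_value d w (Suc n)))"
  (is "convergent ?X")
proof -
  have "Cauchy ?X"
  proof (rule CauchyI')
    fix e :: real assume e: "0 < e"
    \<comment> \<open>Chosen so that \<open>(c - 1) * C = e / 2\<close>.\<close>
    define c where "c = 1 + e / (2 * C)"
    have c: "1 < c" "(c - 1) * C < e" using e C_gt_1 by (simp_all add: c_def)
    obtain n0 where n0: "\<And>n k m l. n0 \<le> n \<Longrightarrow>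
      cell_ratio d F (n + k) (m + int d ^ Suc n * l) \<le> c * cell_ratio d F n m \<and>
      cell_ratio d F n m \<le> c * cell_ratio d F (n + k) (m + int d ^ Suc n * l)"
      using cell_ratio_stable[OF c(1)] by blast
    show "\<exists>N. \<forall>m\<ge>N. \<forall>n>m. dist (?X m) (?X n) < e"
    proof (intro exI allI impI)
      fix m n assume "n0 \<le> m" "m < n"
      obtain k where k: "n = m + k" using \<open>m < n\<close> less_imp_add_positive by blast
      obtain l where "digit_value d w (Suc n) = digit_value d w (Suc m) + int d ^ Suc m * l"
        using digit_value_extend[of d w "Suc m" k] k by auto
      then have "?X n \<le> c * ?X m" "?X m \<le> c * ?X n"
        using n0[OF \<open>n0 \<le> m\<close>, of k "digit_value d w (Suc m)" l] k by simp_all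
      then have "\<bar>?X m - ?X n\<bar> \<le> max ((c - 1) * ?X m) ((c - 1) * ?X n)"
        by (auto simp: abs_le_iff le_max_iff_disj algebra_simps)
      also have "\<dots> \<le> (c - 1) * C"
        using c(1) cell_ratio_bounds(2) by (simp add: mult_left_mono)
      finally show "dist (?X m) (?X n) < e" using c(2) by (simp add: dist_real_def)
    qed
  qed
  then show ?thesis by (rule real_Cauchy_convergent)
qed

lemma cell_ratio_digits_tendsto:
  assumes "endo_lift d f = F" and "w \<in> dual_sequences d"
  shows "(\<lambda>n. cell_ratio d F n (digit_value d w (Suc n))) \<longlonglongrightarrow> dual_derivative d f w"
  unfolding dual_derivative_eq_lim[OF assms]
  using cell_ratio_digits_convergent convergent_LIMSEQ_iff by blast

text \<open>Let \<open>k\<close> tend to infinity in \<open>cell_ratio_stable\<close>. The level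
  \<open>n0\<close> is the same for all sequences, which later allows all cells of a level to be
  treated together.\<close>

lemma cell_ratio_near_dual_derivative:
  assumes "1 < c" and f: "endo_lift d f = F"
  obtains n0 where "\<And>n w. n0 \<le> n \<Longrightarrow> w \<in> dual_sequences d \<Longrightarrow>
    dual_derivative d f w \<le> c * cell_ratio d F n (digit_value d w (Suc n)) \<and>
    cell_ratio d F n (digit_value d w (Suc n)) \<le> c * dual_derivative d f w"
proof -
  obtain n0 where n0: "\<And>n k m l. n0 \<le> n \<Longrightarrow>
    cell_ratio d F (n + k) (m + int d ^ Suc n * l) \<le> c * cell_ratio d F n m \<and>
    cell_ratio d F n m \<le> c * cell_ratio d F (n + k) (m + int d ^ Suc n * l)"
    using cell_ratio_stable[OF assms(1)] by blast
  show ?thesis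
  proof (rule that)
    fix n w assume n: "n0 \<le> n" and w: "w \<in> dual_sequences d"
    let ?X = "\<lambda>n. cell_ratio d F n (digit_value d w (Suc n))"
    have X: "?X (n + k) \<le> c * ?X n \<and> ?X n \<le> c * ?X (n + k)" for k
    proof -
      obtain l where "digit_value d w (Suc (n + k)) = digit_value d w (Suc n) + int d ^ Suc n * l"
        using digit_value_extend[of d w "Suc n" k] by auto
      then show ?thesis using n0[OF n, of k "digit_value d w (Suc n)" l] by simp
    qed
    have lim: "(\<lambda>k. ?X (n + k)) \<longlonglongrightarrow> dual_derivative d f w"
      using LIMSEQ_ignore_initial_segment[OF cell_ratio_digits_tendsto[OF f w], of n]
      by (simp add: add.commute)
    have "dual_derivative d f w \<le> c * ?X n"
      by (rule LIMSEQ_le_const2[OF lim]) (use X in blast)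
    moreover have "?X n \<le> c * dual_derivative d f w"
      by (rule LIMSEQ_le_const[OF tendsto_mult_left[OF lim]]) (use X in blast)
    ultimately show "dual_derivative d f w \<le> c * ?X n \<and> ?X n \<le> c * dual_derivative d f w" by blast
  qed
qed

lemma cell_periodic: "cell F n (m + int d ^ n * l) = cell F n m"
  using cell_slope[of n 0 m l] cell_pos[of n m] by (simp add: slope_def cell_\<phi>)

lemma cell_ratio_mod: "cell_ratio d F n (m mod int d ^ Suc n) = cell_ratio d F n m"
proof -
  define r where "r = m mod int d ^ Suc n"
  define l where "l = m div int d ^ Suc n"
  have m: "m = r + int d ^ Suc n * l" by (simp add: r_def l_def del: power_Suc)
  have "m div int d = r div int d + int d ^ n * l"
    unfolding m using d by (simp add: mult.assoc div_add)
  then show ?thesis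
    unfolding cell_ratio_def r_def[symmetric] using cell_periodic[of n _ l] cell_periodic[of "Suc n" r l]
    by (simp only: m[symmetric])
qed

end

text \<open>Both ratios are close to the common dual derivative of a sequence whose digits give
  \<open>m\<close> modulo \<open>d ^ Suc n\<close>; each of the two comparisons costs
  \<open>sqrt c\<close>.\<close>

lemma cell_ratios_comparable_of_dual_derivatives:
  assumes F: "uniform_lift d F \<epsilon>" and G: "uniform_lift d G \<delta>" and c: "1 < c"
    and f: "endo_lift d f = F" and g: "endo_lift d g = G"
    and eq: "\<And>w. w \<in> dual_sequences d \<Longrightarrow> dual_derivative d f w = dual_derivative d g w"
  shows "\<exists>n0. \<forall>n\<ge>n0. \<forall>m. cell_ratio d F n m \<le> c * cell_ratio d G n m"
proof -
  interpret F: uniform_lift d F \<epsilon> by fact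
  interpret G: uniform_lift d G \<delta> by fact
  define b where "b = sqrt c"
  have b: "1 < b" "b * b = c" using c by (auto simp: b_def)
  obtain nF where nF: "\<And>n w. nF \<le> n \<Longrightarrow> w \<in> dual_sequences d \<Longrightarrow>
    cell_ratio d F n (digit_value d w (Suc n)) \<le> b * dual_derivative d f w"
    using F.cell_ratio_near_dual_derivative[OF b(1) f] by metis
  obtain nG where nG: "\<And>n w. nG \<le> n \<Longrightarrow> w \<in> dual_sequences d \<Longrightarrow>
    dual_derivative d g w \<le> b * cell_ratio d G n (digit_value d w (Suc n))"
    using G.cell_ratio_near_dual_derivative[OF b(1) g] by metis
  show ?thesis
  proof (intro exI allI impI)
    fix n m assume n: "max nF nG \<le> n"
    \<comment> \<open>Floor division gives digits in the right range for negative \<open>m\<close>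
      too.\<close>
    define w where "w k = nat (m div int d ^ k mod int d)" for k
    have w: "w \<in> dual_sequences d"
      using F.d by (auto simp: w_def dual_sequences_def nat_less_iff)
    have v: "digit_value d w (Suc n) = m mod int d ^ Suc n"
      unfolding w_def using F.d by (intro digit_value_digits) simp
    have "cell_ratio d F n m \<le> b * dual_derivative d f w"
      using nF[OF _ w, of n] n unfolding v F.cell_ratio_mod by simp
    also have "\<dots> \<le> b * (b * cell_ratio d G n m)"
      using nG[OF _ w, of n] n b(1) eq[OF w] unfolding v G.cell_ratio_mod by (intro mult_left_mono) auto
    finally show "cell_ratio d F n m \<le> c * cell_ratio d G n m" by (simp add: mult.assoc[symmetric] b(2))
  qed
qed

lemma int_div_pred_eq: "\<not> D dvd m \<Longrightarrow> 0 < D \<Longrightarrow> (m - 1) div D = m div (D :: int)"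
proof -
  assume "\<not> D dvd m" "0 < D"
  then have "0 < m mod D" by (metis dvd_eq_mod_eq_0 order_le_less pos_mod_sign)
  then show ?thesis
    using \<open>0 < D\<close> pos_mod_bound[OF \<open>0 < D\<close>, of m] mult_div_mod_eq[of D m]
    by (intro int_div_pos_eq[of _ _ _ "m mod D - 1"]) auto
qed

section \<open>Distortion of cells under a conjugacy\<close>

locale conjugate_lifts = F: uniform_lift d F \<epsilon> + G: uniform_lift d G \<delta>
  for d :: nat and F \<epsilon> G \<delta> +
  fixes H :: "real \<Rightarrow> real"
  assumes mono_H: "strict_mono H" and H_0: "H 0 = 0" and H_add_1: "H (x + 1) = H x + 1"
    and conj: "H (F x) = G (H x)"
begin

lemma H_int: "H (of_int k) = of_int k"
proof (induction k rule: int_induct[where k = 0])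
  case (step1 i)
  then show ?case using H_add_1[of "of_int i"] by simp
next
  case (step2 i)
  then show ?case using H_add_1[of "of_int (i - 1)"] by simp
qed (simp add: H_0)

lemma H_\<phi>: "H (F.\<phi> n x) = G.\<phi> n (H x)"
proof (induction n)
  case (Suc n)
  have "H (inv F y) = inv G (H y)" for y
    by (metis F.F_inv_F G.inv_F_F conj)
  then show ?case using Suc by (simp add: F.inv_F_\<phi> G.inv_F_\<phi>)
qed simp

definition R :: "nat \<Rightarrow> int \<Rightarrow> real" where "R n m = cell G n m / cell F n m"

lemma R_pos: "0 < R n m"
  by (simp add: R_def F.cell_pos G.cell_pos)

text \<open>\<open>H\<close> intertwines the inverse iterates and fixes the integers, so it maps
  each cell of \<open>F\<close> onto the cell of \<open>G\<close> with the same index.\<close>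

lemma R_slope: "R n m = slope H (F.\<phi> n (of_int m)) (F.\<phi> n (of_int (m + 1)))"
  unfolding R_def slope_def H_\<phi> H_int by (simp only: F.cell_\<phi> G.cell_\<phi>)

text \<open>Comparing the cell ratios of \<open>F\<close> and \<open>G\<close> thus amounts to
  comparing \<open>R\<close> on a parent and its child.\<close>

lemma cell_ratio_R: "cell_ratio d G n m = R n (m div int d) / R (Suc n) m * cell_ratio d F n m"
  using F.cell_pos[of n "m div int d"] F.cell_pos[of "Suc n" m]
  by (simp add: cell_ratio_def R_def)

text \<open>By \<open>cell_ratio_R\<close> and \<open>R_slope\<close> the two ratios differ by the
  quotient of the slopes of \<open>H\<close> over a parent and its child, which is close to 1 at
  small scales.\<close>

lemma cell_ratios_comparable_of_symmetric:
  assumes e: "vanishing_gauge e" and H: "symmetric_with e H" and c: "1 < c"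
  shows "\<exists>n0. \<forall>n\<ge>n0. \<forall>m. cell_ratio d G n m \<le> c * cell_ratio d F n m \<and>
    cell_ratio d F n m \<le> c * cell_ratio d G n m"
proof -
  obtain t0 where t0: "0 < t0"
    "\<And>K a b u v u' v'. \<lbrakk>strict_mono K; symmetric_with e K; b - a < t0;
       a \<le> u; u < v; v \<le> b; a \<le> u'; u' < v'; v' \<le> b; b - a \<le> F.C * (v - u); b - a \<le> F.C * (v' - u')\<rbrakk>
      \<Longrightarrow> slope K u v \<le> c * slope K u' v'"
    using symmetric_slopes_comparable[OF e less_trans[OF zero_less_one F.C_gt_1] c] by metis
  obtain n0 where n0: "\<And>n m. n0 \<le> n \<Longrightarrow> cell F n m < t0"
    using F.cells_small[OF t0(1)] by blast
  have "cell_ratio d G n m \<le> c * cell_ratio d F n m \<and> cell_ratio d F n m \<le> c * cell_ratio d G n m"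
    if n: "n0 \<le> n" for n m
  proof -
    define p where "p = m div int d"
    define a where "a = F.\<phi> n (of_int p)"
    define b where "b = F.\<phi> n (of_int (p + 1))"
    define u where "u = F.\<phi> (Suc n) (of_int m)"
    define v where "v = F.\<phi> (Suc n) (of_int (m + 1))"
    have [simp]: "b - a = cell F n p" "v - u = cell F (Suc n) m"
      by (simp_all add: a_def b_def u_def v_def F.cell_\<phi>)
    have ab: "a < b" "u < v" by (simp_all add: a_def b_def u_def v_def)
    have sub: "a \<le> u" "v \<le> b"
      using F.child_inside[of n m] by (simp_all only: a_def b_def u_def v_def p_def)
    have len: "cell F n p \<le> F.C * cell F (Suc n) m" "cell F n p \<le> F.C * cell F n p"
      using F.cell_parent_le[of n m] F.C_gt_1 F.cell_pos[of n p] by (simp_all add: p_def)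
    have "slope H a b \<le> c * slope H u v" "slope H u v \<le> c * slope H a b"
      by (rule t0(2)[OF mono_H H, of b a]; use n0[OF n] ab sub len in simp)+
    then have "R n p / R (Suc n) m \<le> c" "1 \<le> c * (R n p / R (Suc n) m)"
      using R_pos[of "Suc n" m]
      by (simp_all add: R_slope a_def b_def u_def v_def divide_le_eq le_divide_eq)
    then have "R n p / R (Suc n) m * cell_ratio d F n m \<le> c * cell_ratio d F n m"
      "1 * cell_ratio d F n m \<le> c * (R n p / R (Suc n) m) * cell_ratio d F n m"
      using F.cell_ratio_bounds(1)[of n m] by (intro mult_right_mono; simp)+
    then show ?thesis
      unfolding cell_ratio_R p_def[symmetric] by (simp only: mult.assoc mult_1)
  qed
  then show ?thesis by blast
qed

lemma R_descendant:
  assumes c: "1 \<le> c" and n: "n0 \<le> n"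
    and cmp: "\<And>n m. n0 \<le> n \<Longrightarrow> cell_ratio d G n m \<le> c * cell_ratio d F n m \<and>
      cell_ratio d F n m \<le> c * cell_ratio d G n m"
  shows "R (n + s) m \<le> c ^ s * R n (m div int d ^ s) \<and> R n (m div int d ^ s) \<le> c ^ s * R (n + s) m"
proof (induction s arbitrary: m)
  case (Suc s)
  define p where "p = m div int d"
  define q where "q = R (n + s) p / R (Suc (n + s)) m"
  have pos: "0 < R (n + s) p" "0 < R (Suc (n + s)) m" "0 < cell_ratio d F (n + s) m"
    using R_pos F.cell_ratio_bounds(1)[of "n + s" m] by auto
  have "q * cell_ratio d F (n + s) m \<le> c * cell_ratio d F (n + s) m"
    "1 * cell_ratio d F (n + s) m \<le> (c * q) * cell_ratio d F (n + s) m"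
    using cmp[of "n + s" m] n unfolding cell_ratio_R q_def p_def by (simp_all add: mult.assoc)
  then have "q \<le> c" "1 \<le> c * q"
    using pos(3) by (simp_all only: mult_le_cancel_right_pos)
  then have step: "R (n + s) p \<le> c * R (Suc (n + s)) m" "R (Suc (n + s)) m \<le> c * R (n + s) p"
    using pos by (simp_all add: q_def divide_le_eq le_divide_eq)
  have IH: "R (n + s) p \<le> c ^ s * R n (m div int d ^ Suc s)" "R n (m div int d ^ Suc s) \<le> c ^ s * R (n + s) p"
    using Suc[of p] by (simp_all add: p_def zdiv_zmult2_eq)
  have "R (n + Suc s) m \<le> c * (c ^ s * R n (m div int d ^ Suc s))"
    using order_trans[OF step(2) mult_left_mono[OF IH(1), of c]] c by simp
  moreover have "R n (m div int d ^ Suc s) \<le> c ^ s * (c * R (n + Suc s) m)"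
    using order_trans[OF IH(2) mult_left_mono[OF step(1), of "c ^ s"]] c by simp
  ultimately show ?case by (simp add: mult_ac)
qed simp

lemma R_neighbours:
  assumes cmp: "\<And>c. 1 < c \<Longrightarrow> \<exists>n0. \<forall>n\<ge>n0. \<forall>m. cell_ratio d G n m \<le> c * cell_ratio d F n m \<and>
      cell_ratio d F n m \<le> c * cell_ratio d G n m"
    and c: "1 < c"
  shows "\<exists>n1. \<forall>n\<ge>n1. \<forall>m. R n m \<le> c * R n (m - 1) \<and> R n (m - 1) \<le> c * R n m"
proof -
  \<comment> \<open>The longest chain of comparisons below has five links.\<close>
  define b where "b = root 5 c"
  have b: "1 < b" "b ^ 5 = c" using c by (auto simp: b_def)
  obtain rF where rF: "\<And>r k l. rF \<le> r \<Longrightarrow>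
    cell F (r + k) (int d ^ r * l) / cell F (r + k) (int d ^ r * l - 1) \<le> b * (cell F r 0 / cell F r (-1)) \<and>
    cell F r 0 / cell F r (-1) \<le> b * (cell F (r + k) (int d ^ r * l) / cell F (r + k) (int d ^ r * l - 1))"
    using F.neighbours_at_multiples_stable[OF b(1)] by metis
  obtain rG where rG: "\<And>r k l. rG \<le> r \<Longrightarrow>
    cell G (r + k) (int d ^ r * l) / cell G (r + k) (int d ^ r * l - 1) \<le> b * (cell G r 0 / cell G r (-1)) \<and>
    cell G r 0 / cell G r (-1) \<le> b * (cell G (r + k) (int d ^ r * l) / cell G (r + k) (int d ^ r * l - 1))"
    using G.neighbours_at_multiples_stable[OF b(1)] by metis
  define r where "r = max rF rG"
  \<comment> \<open>One more than \<open>r\<close>, so that \<open>d ^ s\<close> does not divide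
    \<open>d ^ r\<close> and the ancestor argument applies at the point
    \<open>d ^ r\<close>.\<close>
  define s where "s = Suc r"
  \<comment> \<open>The path through the common ancestor has \<open>s\<close> generations up and
    \<open>s\<close> down, each costing \<open>a\<close>.\<close>
  define a where "a = root (2 * s) b"
  have a: "1 < a" "a ^ (2 * s) = b"
  proof -
    show "1 < a" using b(1) by (simp add: a_def s_def)
    show "a ^ (2 * s) = b"
      unfolding a_def by (rule real_root_pow_pos2) (use b(1) in \<open>simp_all add: s_def\<close>)
  qed
  obtain n0 where n0: "\<And>n m. n0 \<le> n \<Longrightarrow> cell_ratio d G n m \<le> a * cell_ratio d F n m \<and>
      cell_ratio d F n m \<le> a * cell_ratio d G n m"
    using cmp[OF a(1)] by blast
  have ancestor: "R n m \<le> b * R n (m - 1) \<and> R n (m - 1) \<le> b * R n m"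
    if n: "n0 + s \<le> n" and m: "\<not> int d ^ s dvd m" for n m
  proof -
    define k where "k = n - s"
    have k: "n = k + s" "n0 \<le> k" using n by (auto simp: k_def)
    have "(m - 1) div int d ^ s = m div int d ^ s"
      using int_div_pred_eq[OF m] F.d by simp
    then have *: "R n j \<le> a ^ s * R k (m div int d ^ s)" "R k (m div int d ^ s) \<le> a ^ s * R n j"
      if "j \<in> {m, m - 1}" for j
      using R_descendant[of a n0 k s j] n0 a(1) k that by auto
    have "R n i \<le> a ^ s * (a ^ s * R n j)" if "i \<in> {m, m - 1}" "j \<in> {m, m - 1}" for i j
      using order_trans[OF *(1)[OF that(1)] mult_left_mono[OF *(2)[OF that(2)], of "a ^ s"]] a(1) by simp
    then show ?thesis
      unfolding a(2)[symmetric] mult_2 power_add by (simp add: mult.assoc)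
  qed
  define sF where "sF n m = cell F n m / cell F n (m - 1)" for n m
  define sG where "sG n m = cell G n m / cell G n (m - 1)" for n m
  have s_pos: "0 < sF n m" "0 < sG n m" for n m
    by (simp_all add: sF_def sG_def F.cell_pos G.cell_pos)
  have R_s: "R n m = sG n m / sF n m * R n (m - 1)" for n m
    using F.cell_pos[of n "m - 1"] G.cell_pos[of n "m - 1"] F.cell_pos[of n m]
    by (simp add: R_def sF_def sG_def)
  \<comment> \<open>The quotient of \<open>R\<close> at neighbours is
    \<open>sG n m / sF n m\<close>, so it remains to compare the quotients of adjacent cells for
    \<open>F\<close> and for \<open>G\<close>.\<close>
  have R_iff: "R n m \<le> x * R n (m - 1) \<longleftrightarrow> sG n m \<le> x * sF n m"
    "R n (m - 1) \<le> x * R n m \<longleftrightarrow> sF n m \<le> x * sG n m" for n m x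
  proof -
    have "R n m \<le> x * R n (m - 1) \<longleftrightarrow> sG n m / sF n m \<le> x"
      unfolding R_s[of n m] using R_pos by (rule mult_le_cancel_right_pos)
    then show "R n m \<le> x * R n (m - 1) \<longleftrightarrow> sG n m \<le> x * sF n m"
      using s_pos by (simp add: divide_le_eq)
    have "R n (m - 1) \<le> x * R n m \<longleftrightarrow> 1 * R n (m - 1) \<le> (x * (sG n m / sF n m)) * R n (m - 1)"
      unfolding R_s[of n m] by (simp only: mult.assoc mult_1)
    also have "\<dots> \<longleftrightarrow> 1 \<le> x * (sG n m / sF n m)"
      using R_pos by (rule mult_le_cancel_right_pos)
    finally show "R n (m - 1) \<le> x * R n m \<longleftrightarrow> sF n m \<le> x * sG n m"
      using s_pos by (simp add: le_divide_eq)
  qed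
  define N where "N = n0 + s"
  have rN: "r \<le> N" by (simp add: N_def s_def)
  have SF: "sF n (int d ^ r * l) \<le> b * sF r 0" "sF r 0 \<le> b * sF n (int d ^ r * l)" if "r \<le> n" for n l
    using rF[of r "n - r" l] that by (simp_all add: r_def sF_def)
  have SG: "sG n (int d ^ r * l) \<le> b * sG r 0" "sG r 0 \<le> b * sG n (int d ^ r * l)" if "r \<le> n" for n l
    using rG[of r "n - r" l] that by (simp_all add: r_def sG_def)
  \<comment> \<open>The point \<open>d ^ r\<close> of level \<open>N\<close> is the reference at
    which the \<open>F\<close> and \<open>G\<close> quotients are compared directly.\<close>
  have "\<not> int d ^ s dvd int d ^ r * 1"
    using F.d by (simp add: s_def power_dvd_imp_le del: power_Suc) (auto dest: dvd_imp_le)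
  then have mid: "sG N (int d ^ r * 1) \<le> b * sF N (int d ^ r * 1)" "sF N (int d ^ r * 1) \<le> b * sG N (int d ^ r * 1)"
    using ancestor[of N "int d ^ r * 1"] unfolding N_def R_iff by auto
  have chain: "x1 \<le> c * x6" if "x1 \<le> b * x2" "x2 \<le> b * x3" "x3 \<le> b * x4" "x4 \<le> b * x5" "x5 \<le> b * x6"
    for x1 x2 x3 x4 x5 x6 :: real
  proof -
    have b0: "0 \<le> b" using b(1) by simp
    have "x1 \<le> b * (b * (b * (b * (b * x6))))"
      by (rule order_trans[OF that(1) mult_left_mono[OF order_trans[OF that(2) mult_left_mono[OF
        order_trans[OF that(3) mult_left_mono[OF order_trans[OF that(4) mult_left_mono[OF that(5) b0]] b0]] b0]] b0]])
    then show ?thesis unfolding b(2)[symmetric] by (simp add: eval_nat_numeral mult.assoc)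
  qed
  have "b \<le> c"
    using power_increasing[of 1 5 b] b by simp
  have "R n m \<le> c * R n (m - 1) \<and> R n (m - 1) \<le> c * R n m" if n: "N \<le> n" for n m
  proof (cases "int d ^ r dvd m")
    case True
    then obtain l where l: "m = int d ^ r * l" by (elim dvdE)
    have "r \<le> n" using n rN by simp
    \<comment> \<open>The links lead from \<open>m\<close> at level \<open>n\<close> to 0 at level
      \<open>r\<close>, on to the reference point at level \<open>N\<close>, across to the other
      map, and back by the same stations.\<close>
    then have "sG n m \<le> c * sF n m" "sF n m \<le> c * sG n m"
      unfolding l using chain[OF SG(1)[of n l] SG(2)[OF rN, of 1] mid(1) SF(1)[OF rN, of 1] SF(2)[of n l]]
        chain[OF SF(1)[of n l] SF(2)[OF rN, of 1] mid(2) SG(1)[OF rN, of 1] SG(2)[of n l]] by simp_all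
    then show ?thesis by (simp add: R_iff)
  next
    case False
    then have "\<not> int d ^ s dvd m"
      using dvd_trans[OF le_imp_power_dvd[of r s "int d"]] by (auto simp: s_def)
    then have "R n m \<le> b * R n (m - 1)" "R n (m - 1) \<le> b * R n m"
      using ancestor[of n m] n by (auto simp: N_def)
    moreover have "b * R n (m - 1) \<le> c * R n (m - 1)" "b * R n m \<le> c * R n m"
      using \<open>b \<le> c\<close> R_pos less_imp_le by (intro mult_right_mono; blast)+
    ultimately show ?thesis by linarith
  qed
  then show ?thesis by blast
qed

end

section \<open>From neighbouring cells to symmetry\<close>

text \<open>The symmetry condition at one scale, cleared of denominators; the gauge is assembled
  from the separate scales afterwards.\<close>

definition comparable_at :: "(real \<Rightarrow> real) \<Rightarrow> real \<Rightarrow> real \<Rightarrow> bool"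
  where "comparable_at K c t \<longleftrightarrow> (\<forall>x. K (x + t) - K x \<le> c * (K x - K (x - t)) \<and>
    K x - K (x - t) \<le> c * (K (x + t) - K x))"

lemma comparable_at_mono:
  assumes "strict_mono K" "0 < t" "c \<le> c'" "comparable_at K c t"
  shows "comparable_at K c' t"
  unfolding comparable_at_def
proof (intro allI)
  fix x
  have "0 < K (x + t) - K x" "0 < K x - K (x - t)"
    using assms by (simp_all add: strict_mono_less)
  then have "c * (K x - K (x - t)) \<le> c' * (K x - K (x - t))"
    "c * (K (x + t) - K x) \<le> c' * (K (x + t) - K x)"
    using assms(3) by (auto intro!: mult_right_mono)
  then show "K (x + t) - K x \<le> c' * (K x - K (x - t)) \<and> K x - K (x - t) \<le> c' * (K (x + t) - K x)"
    using assms(4) unfolding comparable_at_def by (meson order_trans)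
qed

lemma symmetric_withI:
  assumes "strict_mono K" and "\<And>t. 0 < t \<Longrightarrow> 0 < \<epsilon> t \<and> comparable_at K (1 + \<epsilon> t) t"
  shows "symmetric_with \<epsilon> K"
  unfolding symmetric_with_def
proof (intro allI impI)
  fix x t :: real assume t: "0 < t"
  have "0 < K (x + t) - K x" "0 < K x - K (x - t)"
    using assms t by (simp_all add: strict_mono_less)
  moreover have "K (x + t) - K x \<le> (1 + \<epsilon> t) * (K x - K (x - t))"
    "K x - K (x - t) \<le> (1 + \<epsilon> t) * (K (x + t) - K x)" "0 < \<epsilon> t"
    using assms(2)[OF t] unfolding comparable_at_def by blast+
  ultimately show "1 / (1 + \<epsilon> t) \<le> \<bar>K (x + t) - K x\<bar> / \<bar>K x - K (x - t)\<bar> \<and>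
    \<bar>K (x + t) - K x\<bar> / \<bar>K x - K (x - t)\<bar> \<le> 1 + \<epsilon> t"
    by (simp add: field_simps)
qed

text \<open>Increments of \<open>K\<close> over length \<open>t\<close> lie between
  \<open>t - 1\<close> and \<open>t + 1\<close>, which settles large \<open>t\<close>. For
  \<open>t\<close> between \<open>t0\<close> and 2, periodicity and compactness bound the increments
  away from 0.\<close>

lemma degree_one_comparable_bounded:
  assumes K: "strict_mono K" and cont: "continuous_on UNIV K"
    and K1: "\<And>x. K (x + 1) = K x + 1" and t0: "0 < t0"
    and small: "\<And>t. 0 < t \<Longrightarrow> t < t0 \<Longrightarrow> comparable_at K 2 t"
  shows "\<exists>B\<ge>1. \<forall>t>0. comparable_at K B t"
proof -
  have K_int: "K (x + of_int k) = K x + of_int k" for x k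
  proof (induction k rule: int_induct[where k = 0])
    case (step1 i)
    then show ?case using K1[of "x + of_int i"] by (simp add: algebra_simps)
  next
    case (step2 i)
    then show ?case using K1[of "x + of_int (i - 1)"] by (simp add: algebra_simps)
  qed simp
  have upper: "K (x + t) - K x \<le> t + 1" for x t
  proof -
    have "K (x + t) \<le> K (x + of_int \<lceil>t\<rceil>)" using K by (simp add: strict_mono_less_eq)
    then show ?thesis unfolding K_int by linarith
  qed
  have lower: "t - 1 \<le> K (x + t) - K x" for x t
  proof -
    have "K (x + of_int \<lfloor>t\<rfloor>) \<le> K (x + t)" using K by (simp add: strict_mono_less_eq)
    then show ?thesis unfolding K_int by linarith
  qed
  have "continuous_on {0..1} (\<lambda>x. K (x + t0) - K x)"
    by (intro continuous_intros continuous_on_compose2[OF cont]) auto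
  then obtain x0 where x0: "\<And>y. y \<in> {0..1} \<Longrightarrow> K (x0 + t0) - K x0 \<le> K (y + t0) - K y"
    using continuous_attains_inf[of "{0..1::real}" "\<lambda>x. K (x + t0) - K x"]
    by (metis atLeastatMost_empty_iff2 compact_Icc zero_le_one not_le)
  define \<mu> where "\<mu> = K (x0 + t0) - K x0"
  have \<mu>: "0 < \<mu>" using K t0 by (simp add: \<mu>_def strict_mono_less)
  have \<mu>_le: "\<mu> \<le> K (x + t) - K x" if "t0 \<le> t" for x t
  proof -
    have "\<mu> \<le> K (frac x + t0) - K (frac x)"
      unfolding \<mu>_def by (rule x0) (simp add: frac_lt_1 less_imp_le)
    also have "\<dots> = K (x + t0) - K x"
      using K_int[of "frac x + t0" "\<lfloor>x\<rfloor>"] K_int[of "frac x" "\<lfloor>x\<rfloor>"] by (simp add: frac_def)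
    also have "\<dots> \<le> K (x + t) - K x" using K that by (simp add: strict_mono_less_eq)
    finally show ?thesis .
  qed
  \<comment> \<open>The summand 3 serves \<open>2 < t\<close>, where
    \<open>t + 1 \<le> 3 * (t - 1)\<close>; the summand \<open>3 / \<mu>\<close> serves
    \<open>t \<le> 2\<close>, where increments are at most 3.\<close>
  define B where "B = 3 + 3 / \<mu>"
  have B: "3 \<le> B" "3 / \<mu> \<le> B" using \<mu> by (simp_all add: B_def)
  have le: "K (x + t) - K x \<le> B * (K (y + t) - K y)" if t: "t0 \<le> t" for x y t
  proof (cases "t \<le> 2")
    case True
    have "K (x + t) - K x \<le> (3 / \<mu>) * \<mu>" using upper[of x t] True \<mu> by simp
    also have "\<dots> \<le> B * (K (y + t) - K y)"
      using B \<mu> \<mu>_le[OF t, of y] by (intro mult_mono) auto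
    finally show ?thesis .
  next
    case False
    have "K (x + t) - K x \<le> 3 * (t - 1)" using upper[of x t] False by simp
    also have "\<dots> \<le> B * (K (y + t) - K y)"
      using B lower[of t y] False by (intro mult_mono) auto
    finally show ?thesis .
  qed
  have "comparable_at K B t" if "0 < t" for t
  proof (cases "t < t0")
    case True
    show ?thesis by (rule comparable_at_mono[OF K that _ small[OF that True]]) (use B in simp)
  next
    case False
    then show ?thesis
      using le[of t x "x - t" for x] le[of t "x - t" x for x] by (simp add: comparable_at_def)
  qed
  then show ?thesis using B by (intro exI[of _ B]) auto
qed

lemma symmetric_gauge_exists:
  assumes K: "strict_mono K" and cont: "continuous_on UNIV K" and K1: "\<And>x. K (x + 1) = K x + 1"
    and small: "\<And>c. 1 < c \<Longrightarrow> \<exists>t0>0. \<forall>t. 0 < t \<longrightarrow> t < t0 \<longrightarrow> comparable_at K c t"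
  shows "\<exists>\<epsilon>. vanishing_gauge \<epsilon> \<and> symmetric_with \<epsilon> K"
proof -
  obtain t1 where "0 < t1" "\<And>t. 0 < t \<Longrightarrow> t < t1 \<Longrightarrow> comparable_at K 2 t"
    using small[of 2] by auto
  then obtain B where B: "1 \<le> B" "\<And>t. 0 < t \<Longrightarrow> comparable_at K B t"
    using degree_one_comparable_bounded[OF K cont K1] by blast
  define S where "S t = {e. 0 \<le> e \<and> comparable_at K (1 + e) t}" for t
  \<comment> \<open>The best constant at scale \<open>t\<close>, enlarged by \<open>min 1 t\<close>:
    this makes the gauge positive and admissible even if the infimum is not attained, and keeps it
    bounded and vanishing at 0.\<close>
  define \<epsilon> where "\<epsilon> t = Inf (S t) + min 1 t" for t
  have bdd: "bdd_below (S t)" for t by (rule bdd_belowI[of _ 0]) (auto simp: S_def)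
  have mem: "B - 1 \<in> S t" if "0 < t" for t using B that by (simp add: S_def)
  have Inf0: "0 \<le> Inf (S t)" if "0 < t" for t
    by (rule cInf_greatest) (use mem[OF that] in blast, simp add: S_def)
  have InfB: "Inf (S t) \<le> B - 1" if "0 < t" for t
    by (rule cInf_lower[OF mem[OF that] bdd])
  have \<epsilon>_pos: "0 < \<epsilon> t" if "0 < t" for t using Inf0[OF that] that by (simp add: \<epsilon>_def)
  have "comparable_at K (1 + \<epsilon> t) t" if t: "0 < t" for t
  proof -
    have "Inf (S t) < \<epsilon> t" using t by (simp add: \<epsilon>_def)
    then obtain e where "e \<in> S t" "e < \<epsilon> t"
      using cInf_lessD[of "S t"] mem[OF t] by blast
    then show ?thesis using comparable_at_mono[OF K t, of "1 + e"] by (simp add: S_def)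
  qed
  then have "symmetric_with \<epsilon> K" using \<epsilon>_pos by (intro symmetric_withI[OF K]) auto
  moreover have "bounded (\<epsilon> ` {0<..})"
    unfolding bounded_iff
  proof (intro exI ballI)
    fix y assume "y \<in> \<epsilon> ` {0<..}"
    then obtain t where "0 < t" "y = \<epsilon> t" by auto
    then show "norm y \<le> B" using \<epsilon>_pos[of t] InfB[of t] by (simp add: \<epsilon>_def)
  qed
  moreover have "(\<epsilon> \<longlongrightarrow> 0) (at_right 0)"
  proof (rule order_tendstoI)
    fix a :: real assume "a < 0"
    then show "\<forall>\<^sub>F t in at_right 0. a < \<epsilon> t"
      using \<epsilon>_pos by (auto simp: eventually_at_right_field intro!: exI[of _ 1] dest: less_trans)
  next
    fix a :: real assume a: "0 < a"
    obtain t0 where t0: "0 < t0" "\<And>t. 0 < t \<Longrightarrow> t < t0 \<Longrightarrow> comparable_at K (1 + a / 2) t"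
      using small[of "1 + a / 2"] a by auto
    have "\<epsilon> t < a" if "0 < t" "t < min t0 (a / 2)" for t
    proof -
      have "a / 2 \<in> S t" using a t0 that by (simp add: S_def)
      then have "Inf (S t) \<le> a / 2" using bdd by (rule cInf_lower)
      moreover have "min 1 t < a / 2" using that by auto
      ultimately show ?thesis unfolding \<epsilon>_def by linarith
    qed
    then show "\<forall>\<^sub>F t in at_right 0. \<epsilon> t < a"
      using t0(1) a unfolding eventually_at_right_field by (intro exI[of _ "min t0 (a / 2)"]) auto
  qed
  ultimately show ?thesis using \<epsilon>_pos unfolding vanishing_gauge_def by blast
qed

section \<open>Covering an interval by boundedly many cells\<close>

context uniform_lift
begin

text \<open>If the image stayed shorter than 3, then at each level \<open>[x, y]\<close> would lie
  in four consecutive cells, whose total length tends to 0.\<close>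

lemma exists_expanding_level:
  assumes "x < y"
  shows "\<exists>n. 3 \<le> (F ^^ n) y - (F ^^ n) x"
proof (rule ccontr)
  assume *: "\<not> ?thesis"
  have pos: "0 < (y - x) / (4 * M ^ 4)" using assms M_gt_1 by simp
  obtain n where "\<And>n' m. n \<le> n' \<Longrightarrow> cell F n' m < (y - x) / (4 * M ^ 4)"
    using cells_small[OF pos] by blast
  then have n: "cell F n m < (y - x) / (4 * M ^ 4)" for m by blast
  define p where "p = \<lfloor>(F ^^ n) x\<rfloor>"
  have "(F ^^ n) y < (F ^^ n) x + 3" using * not_le[of 3 "(F ^^ n) y - (F ^^ n) x"] by auto
  then have "of_int p \<le> (F ^^ n) x" "(F ^^ n) y \<le> of_int (p + int 4)"
    unfolding p_def by linarith+
  then have "\<phi> n (of_int p) \<le> x" "y \<le> \<phi> n (of_int (p + int 4))"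
    using \<phi>_le[of n] \<phi>_funpow_F by metis+
  then have "y - x \<le> \<phi> n (of_int (p + int 4)) - \<phi> n (of_int p)" by simp
  also have "\<dots> \<le> real 4 * (M ^ 4 * cell F n p)"
    by (rule interval_le_cell) auto
  also have "\<dots> < y - x"
    using n[of p] M_gt_1 by (simp add: field_simps)
  finally show False by simp
qed

text \<open>The least level at which \<open>[x, y]\<close> has been blown up to length at least 3, so that it
  contains a cell of that level but meets only boundedly many.\<close>

lemma covering_cells:
  assumes xy: "x < y" "y < x + 1"
  obtains n p where "\<phi> n (of_int p) \<le> x" "y \<le> \<phi> n (of_int (p + int (3 * d + 1)))"
    "cell F n (p + 1) \<le> y - x"
proof -
  define n where "n = (LEAST n. 3 \<le> (F ^^ n) y - (F ^^ n) x)"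
  have n: "3 \<le> (F ^^ n) y - (F ^^ n) x"
    unfolding n_def by (rule LeastI_ex[OF exists_expanding_level[OF xy(1)]])
  then have "n \<noteq> 0" using xy by (auto intro: ccontr)
  then obtain k where k: "n = Suc k" using not0_implies_Suc by blast
  \<comment> \<open>One level earlier the length is below 3, and \<open>F\<close> takes length 3 to
    \<open>3 * d\<close>.\<close>
  have "\<not> 3 \<le> (F ^^ k) y - (F ^^ k) x"
    using not_less_Least[of k "\<lambda>n. 3 \<le> (F ^^ n) y - (F ^^ n) x"] k n_def by simp
  then have "F ((F ^^ k) y) \<le> F ((F ^^ k) x + of_int 3)"
    using mono_F by (simp add: strict_mono_less_eq)
  then have le: "(F ^^ n) y \<le> (F ^^ n) x + 3 * real d"
    unfolding F_add_int k by simp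
  \<comment> \<open>The left end falls into cell \<open>p\<close>. Length at least 3 puts the cell
    \<open>p + 1\<close> inside the interval; length at most \<open>3 * d\<close> lets
    \<open>3 * d + 1\<close> cells from \<open>p\<close> on cover it.\<close>
  define p where "p = \<lfloor>(F ^^ n) x\<rfloor>"
  have "of_int p \<le> (F ^^ n) x" "(F ^^ n) x \<le> of_int (p + 1)" unfolding p_def by linarith+
  moreover have "(F ^^ n) y \<le> of_int (p + int (3 * d + 1))" "of_int (p + 1 + 1) \<le> (F ^^ n) y"
    using le n calculation by simp_all
  ultimately have *: "\<phi> n (of_int p) \<le> x" "x \<le> \<phi> n (of_int (p + 1))"
    "y \<le> \<phi> n (of_int (p + int (3 * d + 1)))" "\<phi> n (of_int (p + 1 + 1)) \<le> y"
    using \<phi>_le[of n] \<phi>_funpow_F by metis+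
  show ?thesis
    by (rule that[OF *(1) *(3)]) (use *(2,4) in \<open>simp only: cell_\<phi>\<close>)
qed

end

section \<open>Equality of dual derivatives and symmetry of the conjugacy\<close>

context conjugate_lifts
begin

text \<open>\<open>grid_slope_compare\<close> is applied to \<open>H\<close> on a grid of cells
  covering \<open>[x - t, x + t]\<close>. The number \<open>Q\<close> of cells does not depend on
  \<open>x\<close> and \<open>t\<close>, so \<open>\<eta>\<close> can be fixed in advance.\<close>

lemma comparable_at_small_scales:
  assumes cmp: "\<And>c. 1 < c \<Longrightarrow> \<exists>n0. \<forall>n\<ge>n0. \<forall>m. cell_ratio d G n m \<le> c * cell_ratio d F n m \<and>
      cell_ratio d F n m \<le> c * cell_ratio d G n m"
    and c: "1 < c"
  shows "\<exists>t0>0. \<forall>t. 0 < t \<longrightarrow> t < t0 \<longrightarrow> comparable_at H c t"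
proof -
  obtain \<theta> where \<theta>: "0 < \<theta>" "\<theta> < 1 / 2"
    "\<And>Q. \<exists>\<eta>>1. \<eta> ^ (2 * Q) * ((1 + 2 * \<theta>) / (1 - 2 * \<theta>)) \<le> c"
    using grid_constants[OF c] by blast
  define q where "q = 3 * d + 1"
  have Mq: "0 < F.M ^ q" using F.M_gt_1 by simp
  \<comment> \<open>Each covering cell is at most \<open>M ^ q * (2 * t)\<close>; going
    \<open>N\<close> levels down shrinks it below the mesh \<open>\<theta> * t\<close>.\<close>
  then obtain N where N: "F.\<tau> ^ N < \<theta> / (2 * F.M ^ q)"
    using real_arch_pow_inv[of "\<theta> / (2 * F.M ^ q)" F.\<tau>] \<theta>(1) F.\<tau>(2) by auto
  define D where "D = d ^ N"
  define Q where "Q = q * D"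
  have D: "0 < D" "0 < Q" using F.d by (simp_all add: D_def Q_def q_def)
  obtain \<eta> where \<eta>: "1 < \<eta>" "\<eta> ^ (2 * Q) * ((1 + 2 * \<theta>) / (1 - 2 * \<theta>)) \<le> c"
    using \<theta>(3)[of Q] by blast
  obtain n1 where n1: "\<And>n m. n1 \<le> n \<Longrightarrow> R n m \<le> \<eta> * R n (m - 1) \<and> R n (m - 1) \<le> \<eta> * R n m"
    using R_neighbours[OF cmp \<eta>(1)] by blast
  \<comment> \<open>The bound 1 keeps \<open>[x - t, x + t]\<close> shorter than a period, as
    \<open>covering_cells\<close> requires; the power forces the level of the covering cells to be
    at least \<open>n1\<close>.\<close>
  define t0 where "t0 = min 1 ((1 / F.C) ^ n1) / 2"
  have t0: "0 < t0" using F.C_gt_1 by (simp add: t0_def)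
  have "comparable_at H c t" if t: "0 < t" "t < t0" for t
    unfolding comparable_at_def
  proof (rule allI)
    fix x
    have xt: "x - t < x + t" "x + t < x - t + 1" using t by (simp_all add: t0_def)
    obtain n p where np: "F.\<phi> n (of_int p) \<le> x - t" "x + t \<le> F.\<phi> n (of_int (p + int q))"
      and "cell F n (p + 1) \<le> (x + t) - (x - t)"
      using F.covering_cells[OF xt] unfolding q_def by blast
    then have cell: "cell F n (p + 1) \<le> 2 * t" by simp
    have "(1 / F.C) ^ n < (1 / F.C) ^ n1"
      using F.cell_ge[of n "p + 1"] cell t by (simp add: t0_def)
    then have "n1 \<le> n"
      using power_decreasing[of n n1 "1 / F.C"] F.C_gt_1 by (cases "n1 \<le> n") auto
    define \<Phi> where "\<Phi> i = F.\<phi> (n + N) (of_int (int D * p + int i))" for i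
    have \<Phi>: "strict_mono \<Phi>" by (auto simp: strict_mono_def \<Phi>_def)
    have cells: "\<Phi> (Suc i) - \<Phi> i = cell F (n + N) (int D * p + int i)" for i
      by (simp add: \<Phi>_def F.cell_\<phi> ac_simps)
    have slopes: "slope H (\<Phi> i) (\<Phi> (Suc i)) = R (n + N) (int D * p + int i)" for i
      by (simp add: \<Phi>_def R_slope ac_simps)
    have mesh: "\<Phi> (Suc i) - \<Phi> i \<le> \<theta> * t" if "i < Q" for i
    proof -
      define j where "j = p + int (i div D)"
      have "i div D < q" using that by (simp add: Q_def D less_mult_imp_div_less)
      then have j: "nat \<bar>j - (p + 1)\<bar> \<le> q" by (auto simp: j_def)
      have "(int D * p + int i) div int d ^ N = j"
        using D(1) unfolding j_def D_def by (simp add: zdiv_int)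
      then have "\<Phi> (Suc i) - \<Phi> i \<le> F.\<tau> ^ N * cell F n j"
        unfolding cells using F.cell_descendant_le[of n N "int D * p + int i"] by simp
      also have "cell F n j \<le> F.M ^ q * (2 * t)"
      proof -
        have "cell F n j \<le> F.M ^ nat \<bar>j - (p + 1)\<bar> * cell F n (p + 1)"
          by (rule F.cell_distant)
        also have "\<dots> \<le> F.M ^ q * (2 * t)"
          using j cell F.M_gt_1 F.cell_pos[of n "p + 1"]
          by (intro mult_mono power_increasing) auto
        finally show ?thesis .
      qed
      also have "F.\<tau> ^ N * (F.M ^ q * (2 * t)) \<le> \<theta> / (2 * F.M ^ q) * (F.M ^ q * (2 * t))"
        using N Mq t by (intro mult_right_mono) auto
      also have "\<dots> = \<theta> * t" using F.M_gt_1 by simp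
      finally show ?thesis using F.\<tau>(1) by simp
    qed
    have ends: "\<Phi> 0 \<le> x - t" "x + t \<le> \<Phi> Q"
      using np F.\<phi>_level[of n N p] F.\<phi>_level[of n N "p + int q"]
      by (simp_all add: \<Phi>_def Q_def D_def algebra_simps)
    have nb: "R (n + N) (int D * p + int (Suc i)) \<le> \<eta> * R (n + N) (int D * p + int i)"
      "R (n + N) (int D * p + int i) \<le> \<eta> * R (n + N) (int D * p + int (Suc i))" for i
      using n1[of "n + N" "int D * p + int (Suc i)"] \<open>n1 \<le> n\<close> by (simp_all add: algebra_simps)
    have comp: "slope H u (u + t) \<le> c * slope H v (v + t)"
      if "u \<in> {x - t, x}" "v \<in> {x - t, x}" for u v
    proof -
      have "slope H u (u + t) \<le> \<eta> ^ (2 * Q) * ((1 + 2 * \<theta>) / (1 - 2 * \<theta>)) * slope H v (v + t)"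
      proof (rule grid_slope_compare[OF mono_H \<Phi> D(2) _ _ \<theta>(2)])
        show "\<Phi> 0 \<le> u" "u + t \<le> \<Phi> Q" "\<Phi> 0 \<le> v" "v + t \<le> \<Phi> Q"
          using that ends t by auto
      qed (use \<eta> \<theta> t mesh nb in \<open>auto simp: slopes\<close>)
      also have "\<dots> \<le> c * slope H v (v + t)"
        by (rule mult_right_mono[OF \<eta>(2)]) (use slope_pos[OF mono_H, of v "v + t"] t in simp)
      finally show ?thesis .
    qed
    show "H (x + t) - H x \<le> c * (H x - H (x - t)) \<and> H x - H (x - t) \<le> c * (H (x + t) - H x)"
      using comp[of x "x - t"] comp[of "x - t" x] t
      by (simp add: slope_def divide_le_cancel)
  qed
  then show ?thesis using t0 by blast
qed

lemma symmetric_iff: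
  assumes cont: "continuous_on UNIV H" and f: "endo_lift d f = F" and g: "endo_lift d g = G"
  shows "(\<exists>e. vanishing_gauge e \<and> symmetric_with e H) \<longleftrightarrow>
    (\<forall>w\<in>dual_sequences d. dual_derivative d f w = dual_derivative d g w)"
proof
  assume "\<exists>e. vanishing_gauge e \<and> symmetric_with e H"
  then obtain e where e: "vanishing_gauge e" "symmetric_with e H" by blast
  show "\<forall>w\<in>dual_sequences d. dual_derivative d f w = dual_derivative d g w"
  proof
    fix w assume w: "w \<in> dual_sequences d"
    have "dual_derivative d f w \<le> c * dual_derivative d g w \<and>
      dual_derivative d g w \<le> c * dual_derivative d f w" if c: "1 < c" for c
    proof -
      note lim = F.cell_ratio_digits_tendsto[OF f w] G.cell_ratio_digits_tendsto[OF g w]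
      obtain n0 where n0: "\<And>n m. n0 \<le> n \<Longrightarrow> cell_ratio d G n m \<le> c * cell_ratio d F n m"
        "\<And>n m. n0 \<le> n \<Longrightarrow> cell_ratio d F n m \<le> c * cell_ratio d G n m"
        using cell_ratios_comparable_of_symmetric[OF e c] by blast
      show ?thesis
        using LIMSEQ_le[OF lim(1) tendsto_mult_left[OF lim(2)], of c]
          LIMSEQ_le[OF lim(2) tendsto_mult_left[OF lim(1)], of c] n0 by blast
    qed
    \<comment> \<open>Letting \<open>c\<close> decrease to 1 gives both inequalities without the
      factor.\<close>
    then have ev: "\<forall>\<^sub>F c in at_right 1. dual_derivative d f w \<le> c * dual_derivative d g w"
      "\<forall>\<^sub>F c in at_right 1. dual_derivative d g w \<le> c * dual_derivative d f w"
      unfolding eventually_at_right_field by (intro exI[of _ 2]; simp)+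
    have lim: "((\<lambda>c. c * a) \<longlongrightarrow> 1 * a) (at_right 1)" for a :: real
      by (intro tendsto_intros)
    show "dual_derivative d f w = dual_derivative d g w"
      using tendsto_lowerbound[OF lim ev(1)] tendsto_lowerbound[OF lim ev(2)] by simp
  qed
next
  assume eq: "\<forall>w\<in>dual_sequences d. dual_derivative d f w = dual_derivative d g w"
  have "\<exists>n0. \<forall>n\<ge>n0. \<forall>m. cell_ratio d G n m \<le> c * cell_ratio d F n m \<and>
      cell_ratio d F n m \<le> c * cell_ratio d G n m" if c: "1 < c" for c
  proof -
    have U: "uniform_lift d F \<epsilon>" "uniform_lift d G \<delta>"
      by (rule F.uniform_lift_axioms G.uniform_lift_axioms)+
    obtain nF nG where
      "\<And>n m. nF \<le> n \<Longrightarrow> cell_ratio d F n m \<le> c * cell_ratio d G n m"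
      "\<And>n m. nG \<le> n \<Longrightarrow> cell_ratio d G n m \<le> c * cell_ratio d F n m"
      using cell_ratios_comparable_of_dual_derivatives[OF U c f g]
        cell_ratios_comparable_of_dual_derivatives[OF U(2,1) c g f] eq by metis
    then show ?thesis by (intro exI[of _ "max nF nG"]) auto
  qed
  from symmetric_gauge_exists[OF mono_H cont H_add_1 comparable_at_small_scales[OF this]]
  show "\<exists>e. vanishing_gauge e \<and> symmetric_with e H" by blast
qed

end

section \<open>From circle maps to their lifts\<close>

lemma cis_eq_imp_Ints:
  assumes "cis (2 * pi * x) = cis (2 * pi * y)"
  shows "x - y \<in> \<int>"
proof -
  have "cis (2 * pi * (x - y)) = 1"
    using assms by (simp add: right_diff_distrib flip: cis_divide)
  then have "cos (2 * pi * (x - y)) = 1"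
    by (metis cis.simps(1) one_complex.simps(1))
  then obtain n :: int where "2 * pi * (x - y) = of_int n * 2 * pi"
    by (metis cos_one_2pi_int)
  then show ?thesis by simp
qed

lemma cis_add_int: "cis (2 * pi * (y - of_int k)) = cis (2 * pi * y)"
  by (simp add: right_diff_distrib flip: cis_divide)

lemma continuous_Ints_diff_eq:
  fixes A B :: "real \<Rightarrow> real"
  assumes "continuous_on UNIV A" "continuous_on UNIV B" "\<And>x. A x - B x \<in> \<int>" "A 0 = B 0"
  shows "A x = B x"
proof -
  let ?D = "\<lambda>x. A x - B x"
  have "?D constant_on UNIV"
  proof (rule continuous_discrete_range_constant[OF connected_UNIV])
    show "continuous_on UNIV ?D" using assms by (intro continuous_intros)
    fix y :: real
    have "1 \<le> norm (?D z - ?D y)" if "?D z \<noteq> ?D y" for z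
      using Ints_nonzero_abs_ge1[of "?D z - ?D y"] assms(3) that by auto
    then show "\<exists>e>0. \<forall>z. z \<in> UNIV \<and> ?D z \<noteq> ?D y \<longrightarrow> e \<le> norm (?D z - ?D y)"
      by (intro exI[of _ 1]) auto
  qed
  then have "?D x = ?D 0" unfolding constant_on_def by (metis UNIV_I)
  then show ?thesis using assms(4) by simp
qed

lemma uniform_lift_endo_lift:
  assumes "circle_endomorphism d f" "uniformly_symmetric d f"
  shows "\<exists>\<epsilon>. uniform_lift d (endo_lift d f) \<epsilon>" "circle_lift d f (endo_lift d f)"
proof -
  have F: "circle_lift d f (endo_lift d f) \<and> endo_lift d f 0 = 0"
    unfolding endo_lift_def by (rule theI'[OF endo_lift_ex1[OF assms(1)]])
  then show "circle_lift d f (endo_lift d f)" by blast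
  obtain G where "homeomorphism UNIV UNIV (endo_lift d f) G"
    using F by (auto simp: circle_lift_def)
  then have "bij (endo_lift d f)"
    by (intro bijI injI) (metis UNIV_I homeomorphism_apply1, metis UNIV_I homeomorphism_def)
  then show "\<exists>\<epsilon>. uniform_lift d (endo_lift d f) \<epsilon>"
    using F assms by (auto simp: uniform_lift_def circle_lift_def circle_endomorphism_def uniformly_symmetric_def)
qed

lemma circle_lift_continuous: "circle_lift d f F \<Longrightarrow> continuous_on UNIV F"
  by (auto simp: circle_lift_def homeomorphism_def)

theorem corollary2:
  fixes d :: nat and f g h :: "complex \<Rightarrow> complex"
  assumes "d \<ge> 2"
    and "circle_endomorphism d f" and "uniformly_symmetric d f"
    and "circle_endomorphism d g" and "uniformly_symmetric d g"
    and "orientation_preserving_circle_homeo h" and "h 1 = 1"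
    and "\<forall>z\<in>circle. h (f z) = g (h z)"
  shows "symmetric_circle_homeo h \<longleftrightarrow>
    (\<forall>w\<in>dual_sequences d. dual_derivative d f w = dual_derivative d g w)"
proof -
  define F where "F = endo_lift d f"
  define G where "G = endo_lift d g"
  obtain \<epsilon> \<delta> where F: "uniform_lift d F \<epsilon>" "circle_lift d f F" and G: "uniform_lift d G \<delta>" "circle_lift d g G"
    using uniform_lift_endo_lift[OF assms(2,3)] uniform_lift_endo_lift[OF assms(4,5)]
    unfolding F_def G_def by blast
  interpret F: uniform_lift d F \<epsilon> by (rule F)
  interpret G: uniform_lift d G \<delta> by (rule G)
  \<comment> \<open>Symmetry of \<open>h\<close> speaks of some lift, so the equivalence is shown
    for an arbitrary one, normalised below by an integer that cancels in all differences.\<close>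
  have iff: "(\<exists>e. vanishing_gauge e \<and> symmetric_with e H') \<longleftrightarrow>
    (\<forall>w\<in>dual_sequences d. dual_derivative d f w = dual_derivative d g w)" if H': "circle_lift 1 h H'" for H'
  proof -
    have cis_H': "cis (2 * pi * H' x) = h (cis (2 * pi * x))" for x
      using H' by (simp add: circle_lift_def)
    have "cis (2 * pi * H' 0) = cis (2 * pi * 0)"
      using cis_H'[of 0] assms(7) by simp
    then have "H' 0 \<in> \<int>" using cis_eq_imp_Ints[of "H' 0" 0] by simp
    then obtain k where k: "H' 0 = of_int k" by (rule Ints_cases)
    define H where "H x = H' x - of_int k" for x
    have cis_H: "cis (2 * pi * H x) = h (cis (2 * pi * x))" for x
      unfolding H_def cis_add_int by (rule cis_H')
    have contH: "continuous_on UNIV H"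
      unfolding H_def using circle_lift_continuous[OF H'] by (intro continuous_intros)
    \<comment> \<open>Both sides are continuous lifts of the same circle map, hence differ by
      integers, and they agree at 0.\<close>
    have conj: "H (F x) = G (H x)" for x
    proof (rule continuous_Ints_diff_eq[of "\<lambda>x. H (F x)" "\<lambda>x. G (H x)"])
      show "continuous_on UNIV (\<lambda>x. H (F x))" "continuous_on UNIV (\<lambda>x. G (H x))"
        using continuous_on_compose2[OF contH circle_lift_continuous[OF F(2)]]
          continuous_on_compose2[OF circle_lift_continuous[OF G(2)] contH] by auto
      show "H (F 0) = G (H 0)" by (simp add: H_def k F.F_0 G.F_0)
      fix x
      have "cis (2 * pi * H (F x)) = h (f (cis (2 * pi * x)))"
        using cis_H F(2) by (simp add: circle_lift_def)
      also have "\<dots> = g (h (cis (2 * pi * x)))" using assms(8) by simp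
      also have "\<dots> = cis (2 * pi * G (H x))"
        using cis_H[of x] G(2) by (simp add: circle_lift_def)
      finally show "H (F x) - G (H x) \<in> \<int>" by (rule cis_eq_imp_Ints)
    qed
    interpret conjugate_lifts d F \<epsilon> G \<delta> H
      by unfold_locales (use H' conj in \<open>auto simp: H_def k circle_lift_def strict_mono_def\<close>)
    have "symmetric_with e H' \<longleftrightarrow> symmetric_with e H" for e
      by (simp add: symmetric_with_def H_def)
    then show ?thesis
      using symmetric_iff[OF contH] F_def G_def by simp
  qed
  obtain H0 where "circle_lift 1 h H0"
    using assms(6) by (auto simp: orientation_preserving_circle_homeo_def)
  then show ?thesis
    using iff assms(6) unfolding symmetric_circle_homeo_def by blast
qed

end
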